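(* For any pairs $(\mu_1,\nu_1)$, $(\mu_2,\nu_2)$ of compactly supported distributions (Borel probability measures on $\mathbb R$), $$\mathcal{BP}\bigl((\mu_1,\nu_1)\boxtimes_c(\mu_2,\nu_2)\bigr)=\mathcal{BP}(\mu_1,\nu_1)\boxtimes_c\mathcal{BP}(\mu_2,\nu_2),$$ the identity being understood in terms of algebraic distributions.
   Context: Scalar case ($\mathcal B=\mathcal D=\mathbb C$). An algebraic distribution is a unital linear functional $\mu\colon\mathbb C[\mathcal X]\to\mathbb C$. A compactly supported probability measure on $\mathbb R$ is identified with the functional $P\mapsto\int P\,d\mu$. Transforms (formal power series, convergent near $0$ when moments grow at most exponentially): $M_\mu(z)=\sum_{k\ge0}\mu(\mathcal X^k)z^k$, and $B_\mu$, $R_\nu$, ${}^cR_{\mu,\nu}$ are determined by $$M_\mu(z)-1=B_\mu(z)M_\mu(z),\qquad M_\nu(z)-1=R_\nu(zM_\nu(z)),$$ $$(M_\mu(z)-1)M_\nu(z)=M_\mu(z)\,{}^cR_{\mu,\nu}(zM_\nu(z)).$$ Boolean-to-conditionally-free Bercovici-Pata bijection: $\mathcal{BP}(\mu,\nu)=(\mu',\nu')$ is the pair determined by $R_{\nu'}=B_\nu$ and ${}^cR_{\mu',\nu'}=B_\mu$. c-freeness: let $\mathcal A$ be a unital algebra with two unital linear functionals $\theta,E\colon\mathcal A\to\mathbb C$. Elements $X,Y\in\mathcal A$ are c-free with respect to $(\theta,E)$ if for all $A_1,\dots,A_n$ taken alternately from the unital algebras generated by $X$ and by $Y$, with $E(A_i)=0$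 for all $i$, one has $E(A_1\cdots A_n)=0$ and $\theta(A_1\cdots A_n)=\theta(A_1)\cdots\theta(A_n)$. The pair distribution of $X$ is $(\mu,\nu)$ with $\mu(P)=\theta(P(X))$ and $\nu(P)=E(P(X))$. Multiplicative c-free convolution: $(\mu_1,\nu_1)\boxtimes_c(\mu_2,\nu_2)$ is the pair distribution of $XY$, where $X,Y$ are c-free with pair distributions $(\mu_1,\nu_1)$ and $(\mu_2,\nu_2)$. In particular its second coordinate is the free multiplicative convolution $\nu_1\boxtimes\nu_2$. *)

theory Defs
  imports
    "HOL-Probability.Probability"
    "HOL-Computational_Algebra.Computational_Algebra"
    "HOL-Library.Poly_Mapping"
begin

section \<open>Unital complex algebras\<close>

class complex_algebra_1 = ring_1 +
  fixes scaleC :: "complex \<Rightarrow> 'a \<Rightarrow> 'a"  (infixr \<open>*\<^sub>C\<close> 75)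
  assumes scaleC_add_right: "a *\<^sub>C (x + y) = a *\<^sub>C x + a *\<^sub>C y"
    and scaleC_add_left: "(a + b) *\<^sub>C x = a *\<^sub>C x + b *\<^sub>C x"
    and scaleC_scaleC: "a *\<^sub>C b *\<^sub>C x = (a * b) *\<^sub>C x"
    and scaleC_one: "1 *\<^sub>C x = x"
    and mult_scaleC_left: "(a *\<^sub>C x) * y = a *\<^sub>C (x * y)"
    and mult_scaleC_right: "x * (a *\<^sub>C y) = a *\<^sub>C (x * y)"

definition unital_subalgebra :: "'a::complex_algebra_1 set \<Rightarrow> bool" where
  "unital_subalgebra S \<longleftrightarrow> 1 \<in> S \<and> (\<forall>x\<in>S. \<forall>y\<in>S. x + y \<in> S) \<and>
     (\<forall>x\<in>S. \<forall>y\<in>S. x * y \<in> S) \<and> (\<forall>c. \<forall>x\<in>S. c *\<^sub>C x \<in> S)"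

definition generated_algebra :: "'a::complex_algebra_1 \<Rightarrow> 'a set" where
  "generated_algebra X = unital_subalgebra hull {X}"

text \<open>Evaluation \<open>P(X)\<close> of a complex polynomial at an algebra element.\<close>

definition aeval :: "complex poly \<Rightarrow> 'a::complex_algebra_1 \<Rightarrow> 'a" where
  "aeval P X = (\<Sum>i\<le>degree P. coeff P i *\<^sub>C X ^ i)"

definition unital_functional :: "('a::complex_algebra_1 \<Rightarrow> complex) \<Rightarrow> bool" where
  "unital_functional \<phi> \<longleftrightarrow> Vector_Spaces.linear (*\<^sub>C) (*) \<phi> \<and> \<phi> 1 = 1"


section \<open>Algebraic distributions and their transforms\<close>

type_synonym distr = "complex poly \<Rightarrow> complex"

definition algebraic_distribution :: "distr \<Rightarrow> bool" where
  "algebraic_distribution \<mu> \<longleftrightarrow> Vector_Spaces.linear smult (*) \<mu> \<and> \<mu> 1 = 1"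

definition compactly_supported_distribution :: "real measure \<Rightarrow> bool" where
  "compactly_supported_distribution m \<longleftrightarrow>
     prob_space m \<and> sets m = sets borel \<and> (\<exists>K. compact K \<and> (AE x in m. x \<in> K))"

definition distr_of :: "real measure \<Rightarrow> distr" where
  "distr_of m = (\<lambda>P. \<integral>x. poly P (complex_of_real x) \<partial>m)"

definition moment_series :: "distr \<Rightarrow> complex fps" where
  "moment_series \<mu> = Abs_fps (\<lambda>k. \<mu> (monom 1 k))"

text \<open>
  The equations below determine the series uniquely whenever the distributions are unital:
  the moment series then have constant coefficient \<open>1\<close>, so they are invertible, and
  \<open>z M(z)\<close> is invertible with respect to composition (see the lemmas below).
\<close>

definition B_transform :: "distr \<Rightarrow> complex fps" where
  "B_transform \<mu> = (THE B. moment_series \<mu> - 1 = B * moment_series \<mu>)"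

definition R_transform :: "distr \<Rightarrow> complex fps" where
  "R_transform \<nu> =
     (THE R. moment_series \<nu> - 1 = fps_compose R (fps_X * moment_series \<nu>))"

definition cR_transform :: "distr \<Rightarrow> distr \<Rightarrow> complex fps" where
  "cR_transform \<mu> \<nu> =
     (THE R. (moment_series \<mu> - 1) * moment_series \<nu> =
             moment_series \<mu> * fps_compose R (fps_X * moment_series \<nu>))"

definition BP :: "distr \<times> distr \<Rightarrow> distr \<times> distr" where
  "BP = (\<lambda>(\<mu>, \<nu>). THE (\<mu>', \<nu>').
     algebraic_distribution \<mu>' \<and> algebraic_distribution \<nu>' \<and>
     R_transform \<nu>' = B_transform \<nu> \<and> cR_transform \<mu>' \<nu>' = B_transform \<mu>)"

lemma moment_series_nth_0:
  "algebraic_distribution \<mu> \<Longrightarrow> moment_series \<mu> $ 0 = 1"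
  by (simp add: moment_series_def algebraic_distribution_def)

lemma ex1_fps_compose:
  fixes f g :: "complex fps"
  assumes "g $ 0 = 0" "g $ 1 \<noteq> 0"
  shows "\<exists>!R. f = fps_compose R g"
proof (rule ex1I)
  have inv0: "fps_inv g $ 0 = 0" by (simp add: fps_inv_def)
  show "f = fps_compose (fps_compose f (fps_inv g)) g"
    using assms fps_inv[of g] by (simp add: fps_compose_assoc[symmetric] inv0)
next
  have inv0: "fps_inv g $ 0 = 0" by (simp add: fps_inv_def)
  fix R assume "f = fps_compose R g"
  thus "R = fps_compose f (fps_inv g)"
    using assms fps_inv_right[of g] by (simp add: fps_compose_assoc[symmetric] inv0)
qed

lemma
  assumes "algebraic_distribution \<mu>" "algebraic_distribution \<nu>"
  shows B_transform_ex1: "\<exists>!B. moment_series \<mu> - 1 = B * moment_series \<mu>"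
    and R_transform_ex1:
      "\<exists>!R. moment_series \<nu> - 1 = fps_compose R (fps_X * moment_series \<nu>)"
    and cR_transform_ex1:
      "\<exists>!R. (moment_series \<mu> - 1) * moment_series \<nu> =
            moment_series \<mu> * fps_compose R (fps_X * moment_series \<nu>)"
proof -
  note m = moment_series_nth_0[OF assms(1)] and n = moment_series_nth_0[OF assms(2)]
  have inv: "inverse (moment_series \<mu>) * moment_series \<mu> = 1"
    using m by (simp add: inverse_mult_eq_1)
  have cancel: "a = b * moment_series \<mu> \<longleftrightarrow> b = a * inverse (moment_series \<mu>)" for a b
    by (metis (no_types, lifting) inv mult.assoc mult.commute mult.right_neutral)
  show "\<exists>!B. moment_series \<mu> - 1 = B * moment_series \<mu>"
    unfolding cancel by blast
  show "\<exists>!R. moment_series \<nu> - 1 = fps_compose R (fps_X * moment_series \<nu>)"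
    by (rule ex1_fps_compose) (simp_all add: n)
  have "(moment_series \<mu> - 1) * moment_series \<nu> = moment_series \<mu> * c \<longleftrightarrow>
      (moment_series \<mu> - 1) * moment_series \<nu> * inverse (moment_series \<mu>) = c" for c
    using cancel[of _ c] by (auto simp: mult.commute)
  thus "\<exists>!R. (moment_series \<mu> - 1) * moment_series \<nu> =
            moment_series \<mu> * fps_compose R (fps_X * moment_series \<nu>)"
    using ex1_fps_compose[of "fps_X * moment_series \<nu>"] n by simp
qed


section \<open>Conditional freeness\<close>

text \<open>
  The length \<open>n\<close> of the product is positive; the factors come alternately from the two
  generated algebras, and \<open>b\<close> says which of them comes first.
\<close>

definition c_free ::
  "('a::complex_algebra_1 \<Rightarrow> complex) \<Rightarrow> ('a \<Rightarrow> complex) \<Rightarrow> 'a \<Rightarrow> 'a \<Rightarrow> bool" where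
  "c_free \<theta> E X Y \<longleftrightarrow> (\<forall>As b.
     As \<noteq> [] \<and>
     (\<forall>i<length As. As ! i \<in> generated_algebra (if even i = b then X else Y)) \<and>
     (\<forall>A\<in>set As. E A = 0) \<longrightarrow>
     E (prod_list As) = 0 \<and> \<theta> (prod_list As) = prod_list (map \<theta> As))"

definition pair_distr ::
  "('a::complex_algebra_1 \<Rightarrow> complex) \<Rightarrow> ('a \<Rightarrow> complex) \<Rightarrow> 'a \<Rightarrow> distr \<times> distr" where
  "pair_distr \<theta> E X = (\<lambda>P. \<theta> (aeval P X), \<lambda>P. E (aeval P X))"

text \<open>\<open>c_free_realization \<theta> E X Y p\<^sub>1 p\<^sub>2\<close>: in the algebra \<open>'a\<close>, the elements \<open>X\<close> and \<open>Y\<close> are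
  c-free with pair distributions \<open>p\<^sub>1\<close> and \<open>p\<^sub>2\<close>.\<close>

definition c_free_realization ::
  "('a::complex_algebra_1 \<Rightarrow> complex) \<Rightarrow> ('a \<Rightarrow> complex) \<Rightarrow> 'a \<Rightarrow> 'a \<Rightarrow>
   distr \<times> distr \<Rightarrow> distr \<times> distr \<Rightarrow> bool" where
  "c_free_realization \<theta> E X Y p\<^sub>1 p\<^sub>2 \<longleftrightarrow>
     unital_functional \<theta> \<and> unital_functional E \<and> c_free \<theta> E X Y \<and>
     pair_distr \<theta> E X = p\<^sub>1 \<and> pair_distr \<theta> E Y = p\<^sub>2"


section \<open>Noncommutative polynomials\<close>

datatype 'g word = Word (letters: "'g list")

instantiation word :: (type) monoid_add
begin
definition "0 = Word []"
definition "u + v = Word (letters u @ letters v)"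
instance
  by standard (auto simp: zero_word_def plus_word_def)
end

instantiation complex :: complex_algebra_1
begin
definition scaleC_complex :: "complex \<Rightarrow> complex \<Rightarrow> complex" where
  "scaleC_complex = (*)"
instance
  by standard (simp_all add: scaleC_complex_def algebra_simps)
end

lemma scaleC_zero_right [simp]: "a *\<^sub>C (0::'a::complex_algebra_1) = 0"
  using scaleC_add_right[of a 0 "0::'a"] by simp

lemma scaleC_zero_left [simp]: "0 *\<^sub>C (x::'a::complex_algebra_1) = 0"
  using scaleC_add_left[of 0 0 x] by simp

lemma scaleC_sum_right: "a *\<^sub>C sum f S = (\<Sum>i\<in>S. a *\<^sub>C (f i :: 'a::complex_algebra_1))"
  by (induction S rule: infinite_finite_induct) (simp_all add: scaleC_add_right)

lemma poly_mapping_add_induct [case_names zero single add]: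
  fixes f :: "'a \<Rightarrow>\<^sub>0 'b::monoid_add"
  assumes "P 0" "\<And>k v. P (Poly_Mapping.single k v)" "\<And>f g. P f \<Longrightarrow> P g \<Longrightarrow> P (f + g)"
  shows "P f"
proof (induction f rule: update_induct)
  case const
  show ?case by (rule assms(1))
next
  case (update f a b)
  have "Poly_Mapping.update a b f = Poly_Mapping.single a b + f"
    using update(1)
    by (intro poly_mapping_eqI)
       (auto simp: lookup_update lookup_add lookup_single when_def in_keys_iff)
  thus ?case using assms update by simp
qed

instantiation poly_mapping :: (monoid_add, complex_algebra_1) complex_algebra_1
begin

definition scaleC_poly_mapping ::
    "complex \<Rightarrow> ('a \<Rightarrow>\<^sub>0 'b) \<Rightarrow> 'a \<Rightarrow>\<^sub>0 'b" where
  "scaleC_poly_mapping a f = Poly_Mapping.map ((*\<^sub>C) a) f"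

lemma lookup_scaleC:
  "Poly_Mapping.lookup (a *\<^sub>C f) k = a *\<^sub>C Poly_Mapping.lookup f k" for f :: "'a \<Rightarrow>\<^sub>0 'b"
  unfolding scaleC_poly_mapping_def by (simp add: map.rep_eq when_def)

lemma scaleC_single:
  "a *\<^sub>C Poly_Mapping.single k v = Poly_Mapping.single k (a *\<^sub>C v)"
  for k :: 'a and v :: 'b
  by (rule poly_mapping_eqI) (simp add: lookup_scaleC lookup_single when_def)

lemma scaleC_poly_mapping_add:
  "a *\<^sub>C (f + g) = a *\<^sub>C f + a *\<^sub>C g" for f g :: "'a \<Rightarrow>\<^sub>0 'b"
  by (rule poly_mapping_eqI) (simp add: lookup_scaleC lookup_add scaleC_add_right)

lemma scaleC_poly_mapping_zero: "a *\<^sub>C (0 :: 'a \<Rightarrow>\<^sub>0 'b) = 0"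
  by (rule poly_mapping_eqI) (simp add: lookup_scaleC)

lemma scaleC_poly_mapping_left:
  "(a *\<^sub>C f) * g = a *\<^sub>C (f * g)" for f g :: "'a \<Rightarrow>\<^sub>0 'b"
proof (induction f rule: poly_mapping_add_induct)
  case (single k v)
  show ?case
    by (induction g rule: poly_mapping_add_induct)
       (simp_all add: scaleC_single mult_single mult_scaleC_left distrib_left
          scaleC_poly_mapping_add scaleC_poly_mapping_zero)
qed (simp_all add: distrib_right scaleC_poly_mapping_add scaleC_poly_mapping_zero)

lemma scaleC_poly_mapping_right:
  "f * (a *\<^sub>C g) = a *\<^sub>C (f * g)" for f g :: "'a \<Rightarrow>\<^sub>0 'b"
proof (induction f rule: poly_mapping_add_induct)
  case (single k v)
  show ?case
    by (induction g rule: poly_mapping_add_induct)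
       (simp_all add: scaleC_single mult_single mult_scaleC_right distrib_left
          scaleC_poly_mapping_add scaleC_poly_mapping_zero)
qed (simp_all add: distrib_right scaleC_poly_mapping_add scaleC_poly_mapping_zero)

instance
proof
  fix a b :: complex and x y :: "'a \<Rightarrow>\<^sub>0 'b"
  show "a *\<^sub>C (x + y) = a *\<^sub>C x + a *\<^sub>C y"
    by (rule scaleC_poly_mapping_add)
  show "(a + b) *\<^sub>C x = a *\<^sub>C x + b *\<^sub>C x"
    by (rule poly_mapping_eqI) (simp add: lookup_scaleC lookup_add scaleC_add_left)
  show "a *\<^sub>C b *\<^sub>C x = (a * b) *\<^sub>C x"
    by (rule poly_mapping_eqI) (simp add: lookup_scaleC scaleC_scaleC)
  show "1 *\<^sub>C x = x"
    by (rule poly_mapping_eqI) (simp add: lookup_scaleC scaleC_one)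
qed (rule scaleC_poly_mapping_left scaleC_poly_mapping_right)+

end

text \<open>The free unital complex algebra on two generators.\<close>

type_synonym free_algebra2 = "bool word \<Rightarrow>\<^sub>0 complex"


section \<open>Multiplicative c-free convolution\<close>

text \<open>
  The pair distribution of \<open>X Y\<close> depends only on the pair distributions of \<open>X\<close> and \<open>Y\<close>.
  Since HOL cannot quantify over all algebras inside a definition, realizations in the free
  algebra on two generators are used; no generality is lost, because the functionals of a
  realization in any other algebra can be pulled back along the evaluation homomorphism
  (lemma \<open>c_free_realization_free\<close>).
\<close>

definition mult_c_free_conv ::
  "distr \<times> distr \<Rightarrow> distr \<times> distr \<Rightarrow> distr \<times> distr"  (infixl \<open>\<boxtimes>\<^sub>c\<close> 70) where
  "p\<^sub>1 \<boxtimes>\<^sub>c p\<^sub>2 = (THE p. \<exists>\<theta> E (X :: free_algebra2) Y.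
     c_free_realization \<theta> E X Y p\<^sub>1 p\<^sub>2 \<and> p = pair_distr \<theta> E (X * Y))"

definition free_eval :: "('g \<Rightarrow> 'a) \<Rightarrow> ('g word \<Rightarrow>\<^sub>0 complex) \<Rightarrow> 'a::complex_algebra_1" where
  "free_eval x f = (\<Sum>w\<in>Poly_Mapping.keys f.
     Poly_Mapping.lookup f w *\<^sub>C prod_list (map x (letters w)))"

lemma free_eval_superset:
  assumes "finite S" "Poly_Mapping.keys f \<subseteq> S"
  shows "free_eval x f =
    (\<Sum>w\<in>S. Poly_Mapping.lookup f w *\<^sub>C prod_list (map x (letters w)))"
  unfolding free_eval_def
  by (rule sum.mono_neutral_left) (use assms in \<open>auto simp: in_keys_iff\<close>)

lemma free_eval_add: "free_eval x (f + g) = free_eval x f + free_eval x g"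
  using Poly_Mapping.keys_add[of f g]
  by (simp add: free_eval_superset[of "Poly_Mapping.keys f \<union> Poly_Mapping.keys g"]
        lookup_add scaleC_add_left sum.distrib)

lemma free_eval_zero: "free_eval x 0 = 0"
  by (simp add: free_eval_def)

lemma free_eval_single:
  "free_eval x (Poly_Mapping.single w c) = c *\<^sub>C prod_list (map x (letters w))"
  by (subst free_eval_superset[of "{w}"]) (auto simp: lookup_single)

lemma free_eval_one: "free_eval x 1 = 1"
  using free_eval_single[of x 0 1] by (simp add: zero_word_def scaleC_one flip: single_one)

lemma free_eval_scaleC: "free_eval x (c *\<^sub>C f) = c *\<^sub>C free_eval x f"
  by (induction f rule: poly_mapping_add_induct)
     (simp_all add: free_eval_zero free_eval_add free_eval_single scaleC_single
        scaleC_add_right scaleC_scaleC scaleC_complex_def)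

lemma free_eval_mult: "free_eval x (f * g) = free_eval x f * free_eval x g"
proof (induction f rule: poly_mapping_add_induct)
  case (single k v)
  show ?case
    by (induction g rule: poly_mapping_add_induct)
       (simp_all add: free_eval_zero free_eval_add free_eval_single mult_single plus_word_def
          distrib_left mult_scaleC_left mult_scaleC_right scaleC_scaleC mult.commute)
qed (simp_all add: free_eval_zero free_eval_add distrib_right)

lemma free_eval_power: "free_eval x (f ^ n) = free_eval x f ^ n"
  by (induction n) (simp_all add: free_eval_one free_eval_mult)

lemma free_eval_sum: "free_eval x (sum f S) = (\<Sum>i\<in>S. free_eval x (f i))"
  by (induction S rule: infinite_finite_induct) (simp_all add: free_eval_zero free_eval_add)

lemma free_eval_aeval: "free_eval x (aeval P f) = aeval P (free_eval x f)"
  by (simp add: aeval_def free_eval_sum free_eval_scaleC free_eval_power)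

lemma free_eval_prod_list: "free_eval x (prod_list fs) = prod_list (map (free_eval x) fs)"
  by (induction fs) (simp_all add: free_eval_one free_eval_mult)

lemma unital_subalgebra_generated: "unital_subalgebra (generated_algebra X)"
  unfolding generated_algebra_def by (rule hull_in) (auto simp: unital_subalgebra_def)

lemma free_eval_generated:
  assumes "f \<in> generated_algebra g"
  shows "free_eval x f \<in> generated_algebra (free_eval x g)"
proof -
  let ?G = "generated_algebra (free_eval x g)"
  have "free_eval x g \<in> ?G"
    unfolding generated_algebra_def by (rule hull_inc) simp
  moreover have "unital_subalgebra (free_eval x -` ?G)"
    using unital_subalgebra_generated[of "free_eval x g"]
    by (auto simp: unital_subalgebra_def free_eval_one free_eval_add free_eval_mult
          free_eval_scaleC)
  ultimately have "generated_algebra g \<subseteq> free_eval x -` ?G"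
    unfolding generated_algebra_def[of g] by (intro hull_minimal) auto
  thus ?thesis using assms by auto
qed

lemma unital_functional_iff:
  "unital_functional \<phi> \<longleftrightarrow>
     (\<forall>x y. \<phi> (x + y) = \<phi> x + \<phi> y) \<and> (\<forall>c x. \<phi> (c *\<^sub>C x) = c * \<phi> x) \<and> \<phi> 1 = 1"
proof -
  have "vector_space ((*\<^sub>C) :: complex \<Rightarrow> 'a \<Rightarrow> 'a)"
    by standard (simp_all add: scaleC_add_right scaleC_add_left scaleC_scaleC scaleC_one)
  moreover have "vector_space ((*) :: complex \<Rightarrow> complex \<Rightarrow> complex)"
    by standard (simp_all add: algebra_simps)
  ultimately show ?thesis
    by (auto simp: unital_functional_def Vector_Spaces.linear_iff)
qed

lemma c_free_realization_free:
  fixes X Y :: "'a::complex_algebra_1"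
  assumes "c_free_realization \<theta> E X Y p\<^sub>1 p\<^sub>2"
  shows "\<exists>\<theta>' E' (X' :: free_algebra2) Y'. c_free_realization \<theta>' E' X' Y' p\<^sub>1 p\<^sub>2 \<and>
           pair_distr \<theta>' E' (X' * Y') = pair_distr \<theta> E (X * Y)"
proof -
  define gen :: "bool \<Rightarrow> free_algebra2" where "gen b = Poly_Mapping.single (Word [b]) 1" for b
  define ev where "ev = free_eval (\<lambda>b. if b then X else Y)"
  have ev: "ev (gen True) = X" "ev (gen False) = Y"
    by (simp_all add: ev_def gen_def free_eval_single scaleC_one)
  have pair: "pair_distr (\<theta> \<circ> ev) (E \<circ> ev) f = pair_distr \<theta> E (ev f)" for f
    by (simp add: pair_distr_def ev_def free_eval_aeval)
  have "unital_functional (\<theta> \<circ> ev)" "unital_functional (E \<circ> ev)"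
    using assms by (auto simp: c_free_realization_def unital_functional_iff ev_def
        free_eval_add free_eval_scaleC free_eval_one)
  moreover have "c_free (\<theta> \<circ> ev) (E \<circ> ev) (gen True) (gen False)"
    unfolding c_free_def
  proof (intro allI impI, elim conjE)
    fix As b
    assume "As \<noteq> []"
      and mem: "\<forall>i<length As. As ! i \<in> generated_algebra (if even i = b then gen True else gen False)"
      and "\<forall>A\<in>set As. (E \<circ> ev) A = 0"
    moreover have "ev (As ! i) \<in> generated_algebra (if even i = b then X else Y)"
      if "i < length As" for i
      using free_eval_generated[OF mem[rule_format, OF that], of "\<lambda>b. if b then X else Y"] ev
      by (auto simp: ev_def split: if_splits)
    moreover have "c_free \<theta> E X Y"
      using assms by (simp add: c_free_realization_def)
    ultimately have "E (prod_list (map ev As)) = 0 \<and>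
        \<theta> (prod_list (map ev As)) = prod_list (map \<theta> (map ev As))"
      unfolding c_free_def by (elim allE[of _ "map ev As"] allE[of _ b]) auto
    thus "(E \<circ> ev) (prod_list As) = 0 \<and>
        (\<theta> \<circ> ev) (prod_list As) = prod_list (map (\<theta> \<circ> ev) As)"
      by (simp add: ev_def free_eval_prod_list)
  qed
  ultimately have "c_free_realization (\<theta> \<circ> ev) (E \<circ> ev) (gen True) (gen False) p\<^sub>1 p\<^sub>2"
    using assms by (simp add: c_free_realization_def pair ev)
  moreover have "pair_distr (\<theta> \<circ> ev) (E \<circ> ev) (gen True * gen False) = pair_distr \<theta> E (X * Y)"
    unfolding pair by (simp add: ev_def free_eval_mult flip: ev)
  ultimately show ?thesis by blast
qed

end

theory Submission
  imports Defs
begin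

unbundle no vec_syntax

text \<open>
  Write \<open>B\<^bsub>\<nu>\<^esub>(z) = z k\<^bsub>\<nu>\<^esub>(z)\<close>, so that \<open>M\<^bsub>\<nu>\<^esub> (1 - z k\<^bsub>\<nu>\<^esub>) = 1\<close>. The pair
  \<open>(\<mu>', \<nu>') = BP (\<mu>, \<nu>)\<close> is then given by the substitution \<open>k\<^bsub>\<mu>'\<^esub> = k\<^bsub>\<mu>\<^esub> \<circ> g\<close>,
  \<open>k\<^bsub>\<nu>'\<^esub> = k\<^bsub>\<nu>\<^esub> \<circ> g\<close>, where \<open>g = z (1 + B\<^bsub>\<nu>\<^esub>(g))\<close>. The subordination series
  \<open>w\<^sub>1 = z k\<^bsub>\<nu>2\<^esub>(w\<^sub>2)\<close>, \<open>w\<^sub>2 = z k\<^bsub>\<nu>1\<^esub>(w\<^sub>1)\<close> exist without any assumption on the means,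
  and multiplicative c-free convolution multiplies \<open>k\<^bsub>\<mu>1\<^esub>(w\<^sub>1)\<close> by \<open>k\<^bsub>\<mu>2\<^esub>(w\<^sub>2)\<close> and
  \<open>k\<^bsub>\<nu>1\<^esub>(w\<^sub>1)\<close> by \<open>k\<^bsub>\<nu>2\<^esub>(w\<^sub>2)\<close>. Substituting \<open>g\<close> into the subordination system gives the
  system of the images under \<open>BP\<close>.
\<close>

section \<open>Fixed points of contractions of power series\<close>

text \<open>This is strict contraction in the X-adic metric, phrased by coefficients so that neither
  a metric nor subtraction enters.\<close>

definition fps_contraction :: "('a fps \<Rightarrow> 'a fps) \<Rightarrow> bool" where
  "fps_contraction F \<longleftrightarrow> (\<forall>f g n. (\<forall>i<n. f $ i = g $ i) \<longrightarrow> F f $ n = F g $ n)"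

lemma fps_contraction_unique:
  assumes "fps_contraction F" "F f = f" "F g = g"
  shows "f = g"
proof (rule fps_ext)
  fix n show "f $ n = g $ n"
    by (induction n rule: less_induct) (metis assms fps_contraction_def)
qed

text \<open>Banach's argument: the iterates of \<open>F\<close> starting from 0 stabilise
  coefficient by coefficient.\<close>

lemma fps_contraction_fixed_point:
  fixes F :: "'a::zero fps \<Rightarrow> 'a fps"
  assumes "fps_contraction F"
  obtains f where "F f = f"
proof
  have contr: "F f $ n = F g $ n" if "\<And>i. i < n \<Longrightarrow> f $ i = g $ i" for f g n
    using assms that by (auto simp: fps_contraction_def)
  define s where "s N = (F ^^ N) 0" for N
  have s_Suc: "s (Suc N) = F (s N)" for N
    by (simp add: s_def)
  have step: "s (Suc N) $ i = s N $ i" if "i < N" for N i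
    using that
  proof (induction N arbitrary: i)
    case (Suc N)
    have "F (s (Suc N)) $ i = F (s N) $ i"
      by (rule contr) (use Suc in auto)
    thus ?case by (simp only: s_Suc)
  qed simp
  \<comment> \<open>Coefficient \<open>n\<close> has its final value from iterate
    \<open>Suc n\<close> on, so the diagonal of the iterates is their limit.\<close>
  have stable: "s N $ n = s (Suc n) $ n" if "n < N" for N n
    using that
  proof (induction N)
    case (Suc N)
    thus ?case by (cases "n = N") (simp_all add: step)
  qed simp
  show "F (Abs_fps (\<lambda>n. s (Suc n) $ n)) = Abs_fps (\<lambda>n. s (Suc n) $ n)"
  proof (rule fps_ext)
    fix n
    have "F (Abs_fps (\<lambda>n. s (Suc n) $ n)) $ n = F (s n) $ n"
      by (rule contr) (metis fps_nth_Abs_fps stable)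
    thus "F (Abs_fps (\<lambda>n. s (Suc n) $ n)) $ n = Abs_fps (\<lambda>n. s (Suc n) $ n) $ n"
      by (simp add: s_Suc)
  qed
qed

lemma fps_power_nth_cong:
  fixes f g :: "'a::comm_ring_1 fps"
  assumes "\<And>j. j \<le> n \<Longrightarrow> f $ j = g $ j"
  shows "(f ^ i) $ n = (g ^ i) $ n"
  using assms
proof (induction i arbitrary: n)
  case (Suc i)
  thus ?case by (auto simp: fps_mult_nth intro!: sum.cong)
qed simp

text \<open>Coefficient \<open>n\<close> of \<open>a oo f\<close> is a sum over powers of
  \<open>f\<close> up to \<open>n\<close>, whatever the constant term of \<open>f\<close>. Hence
  maps built from \<open>oo\<close> can be contractions on all power series.\<close>

lemma fps_compose_nth_cong:
  fixes f g :: "'a::comm_ring_1 fps"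
  assumes "\<And>j. j \<le> n \<Longrightarrow> f $ j = g $ j"
  shows "(a oo f) $ n = (a oo g) $ n"
  by (simp add: fps_compose_nth fps_power_nth_cong[of n f g, OF assms])

text \<open>Eliminating \<open>w2\<close> leaves one equation for \<open>w1\<close>. Its outer
  factor \<open>fps_X\<close> delays every coefficient by one degree, which makes it a
  contraction.\<close>

lemma subordination_exists:
  fixes k1 k2 :: "'a::comm_ring_1 fps"
  obtains w1 w2 where "w1 = fps_X * (k2 oo w2)" "w2 = fps_X * (k1 oo w1)"
proof -
  have "fps_contraction (\<lambda>w. fps_X * (k2 oo (fps_X * (k1 oo w))))"
    by (auto simp: fps_contraction_def intro!: fps_compose_nth_cong)
  then obtain w where "fps_X * (k2 oo (fps_X * (k1 oo w))) = w"
    by (rule fps_contraction_fixed_point)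
  thus ?thesis by (intro that[of w "fps_X * (k1 oo w)"]) simp_all
qed

lemma fps_contraction_tree:
  fixes b w :: "'a::comm_ring_1 fps"
  assumes "w $ 0 = 0"
  shows "fps_contraction (\<lambda>v. w * (1 + (b oo v)))"
  unfolding fps_contraction_def
proof (intro allI impI)
  fix f g :: "'a fps" and n
  assume eq: "\<forall>i<n. f $ i = g $ i"
  show "(w * (1 + (b oo f))) $ n = (w * (1 + (b oo g))) $ n"
    unfolding fps_mult_nth
  proof (rule sum.cong)
    fix i assume i: "i \<in> {0..n}"
    \<comment> \<open>For \<open>i = 0\<close> the factor \<open>w $ 0\<close> vanishes; for larger
      \<open>i\<close> only coefficients below \<open>n\<close> enter.\<close>
    have "(b oo f) $ (n - i) = (b oo g) $ (n - i)" if "i \<noteq> 0"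
      by (rule fps_compose_nth_cong) (use i that eq in auto)
    thus "w $ i * (1 + (b oo f)) $ (n - i) = w $ i * (1 + (b oo g)) $ (n - i)"
      by (cases "i = 0") (simp_all add: assms)
  qed simp
qed


section \<open>The Boolean Bercovici-Pata bijection as a substitution\<close>

lemma linear_smult_iff:
  "Vector_Spaces.linear smult (*) \<mu> \<longleftrightarrow>
     (\<forall>x y. \<mu> (x + y) = \<mu> x + \<mu> y) \<and> (\<forall>c x. \<mu> (smult c x) = c * \<mu> x)"
  for \<mu> :: distr
proof -
  have "vector_space (smult :: complex \<Rightarrow> complex poly \<Rightarrow> complex poly)"
    by standard (simp_all add: smult_add_right smult_add_left)
  moreover have "vector_space ((*) :: complex \<Rightarrow> complex \<Rightarrow> complex)"
    by standard (simp_all add: algebra_simps)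
  ultimately show ?thesis
    by (auto simp: Vector_Spaces.linear_iff)
qed

lemma algebraic_distribution_iff:
  "algebraic_distribution \<mu> \<longleftrightarrow>
     (\<forall>x y. \<mu> (x + y) = \<mu> x + \<mu> y) \<and> (\<forall>c x. \<mu> (smult c x) = c * \<mu> x) \<and> \<mu> 1 = 1"
  by (simp add: algebraic_distribution_def linear_smult_iff)

lemma algebraic_distribution_eq_sum:
  assumes "algebraic_distribution \<mu>"
  shows "\<mu> P = (\<Sum>i\<le>degree P. coeff P i * moment_series \<mu> $ i)"
proof -
  have zero: "\<mu> 0 = 0" and add: "\<mu> (x + y) = \<mu> x + \<mu> y" and smult: "\<mu> (smult c x) = c * \<mu> x"
    for x y c
    using assms by (auto simp: algebraic_distribution_iff dest: spec[of _ "0::complex poly"])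
  have sum: "\<mu> (sum f S) = (\<Sum>i\<in>S. \<mu> (f i))" for f and S :: "nat set"
    by (induction S rule: infinite_finite_induct) (simp_all add: zero add)
  have "monom c i = smult c (monom 1 i)" for c :: complex and i
    by (simp add: smult_monom)
  hence monom: "\<mu> (monom c i) = c * \<mu> (monom 1 i)" for c i
    by (metis smult)
  have "\<mu> P = \<mu> (\<Sum>i\<le>degree P. monom (coeff P i) i)"
    by (simp add: poly_as_sum_of_monoms)
  thus ?thesis
    unfolding sum by (simp add: moment_series_def monom[of "coeff P _"])
qed

lemma algebraic_distribution_eqI:
  assumes "algebraic_distribution \<mu>" "algebraic_distribution \<nu>"
    and "moment_series \<mu> = moment_series \<nu>"
  shows "\<mu> = \<nu>"
  using assms by (auto simp: algebraic_distribution_eq_sum)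

text \<open>An algebraic distribution is a free choice of moments, subject only to the moment of
  order 0 being 1.\<close>

lemma algebraic_distribution_exists:
  fixes f :: "complex fps"
  assumes "f $ 0 = 1"
  obtains \<mu> where "algebraic_distribution \<mu>" "moment_series \<mu> = f"
proof
  define \<mu> :: distr where "\<mu> P = (\<Sum>i\<le>degree P. coeff P i * f $ i)" for P
  have \<mu>: "\<mu> P = (\<Sum>i\<le>n. coeff P i * f $ i)" if "degree P \<le> n" for P n
    unfolding \<mu>_def
    by (rule sum.mono_neutral_left) (use that in \<open>auto simp: coeff_eq_0\<close>)
  have "\<mu> (x + y) = \<mu> x + \<mu> y" for x y
    by (simp add: \<mu>[of _ "max (degree x) (degree y)"] degree_add_le distrib_right sum.distrib)
  moreover have "\<mu> (smult c x) = c * \<mu> x" for c x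
    using \<mu>[of "smult c x" "degree x"] by (simp add: degree_smult_le \<mu>_def sum_distrib_left mult.assoc)
  ultimately show "algebraic_distribution \<mu>"
    using assms by (simp add: algebraic_distribution_iff \<mu>_def)
  show "moment_series \<mu> = f"
    by (rule fps_ext) (simp add: moment_series_def \<mu>_def degree_monom_eq if_distrib if_distribR cong: if_cong)
qed

text \<open>This is the series \<open>k\<close> of the overview. For an algebraic distribution the
  B-transform has no constant term, so the shift is exact division by \<open>z\<close>. Since
  \<open>k\<close> ranges bijectively over all power series, it serves as a coordinate on algebraic
  distributions.\<close>

definition boolean_series :: "distr \<Rightarrow> complex fps" where
  "boolean_series \<mu> = fps_shift 1 (B_transform \<mu>)"

lemma
  assumes "algebraic_distribution \<mu>"
  shows B_transform_eq: "B_transform \<mu> = fps_X * boolean_series \<mu>"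
    and moment_series_boolean: "moment_series \<mu> * (1 - fps_X * boolean_series \<mu>) = 1"
proof -
  have B: "moment_series \<mu> - 1 = B_transform \<mu> * moment_series \<mu>"
    unfolding B_transform_def by (rule theI'[OF B_transform_ex1[OF assms assms]])
  have "B_transform \<mu> $ 0 = 0"
    using arg_cong[OF B, of "\<lambda>f. f $ 0"] by (simp add: moment_series_nth_0[OF assms])
  thus eq: "B_transform \<mu> = fps_X * boolean_series \<mu>"
    by (intro fps_ext) (simp add: boolean_series_def)
  show "moment_series \<mu> * (1 - fps_X * boolean_series \<mu>) = 1"
    using B unfolding eq by (simp add: algebra_simps)
qed

lemma boolean_series_unique:
  assumes "algebraic_distribution \<mu>" "moment_series \<mu> * (1 - fps_X * k) = 1"
  shows "boolean_series \<mu> = k"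
proof -
  have "moment_series \<mu> * (1 - fps_X * boolean_series \<mu>) - moment_series \<mu> * (1 - fps_X * k) = 0"
    unfolding moment_series_boolean[OF assms(1)] assms(2) by simp
  hence "moment_series \<mu> * (fps_X * (boolean_series \<mu> - k)) = 0"
    by (simp only: right_diff_distrib) auto
  moreover have "moment_series \<mu> \<noteq> 0"
    using assms(2) by auto
  ultimately have "boolean_series \<mu> - k = 0"
    by (simp only: mult_eq_0_iff fps_X_neq_zero simp_thms)
  thus ?thesis by simp
qed

lemma boolean_series_inject:
  assumes "algebraic_distribution \<mu>" "algebraic_distribution \<nu>"
    and "boolean_series \<mu> = boolean_series \<nu>"
  shows "\<mu> = \<nu>"
proof (rule algebraic_distribution_eqI[OF assms(1,2)])
  show "moment_series \<mu> = moment_series \<nu>"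
    by (metis assms moment_series_boolean mult.assoc mult.commute mult.right_neutral)
qed

lemma boolean_series_exists:
  obtains \<mu> where "algebraic_distribution \<mu>" "boolean_series \<mu> = k"
proof -
  obtain \<mu> where \<mu>: "algebraic_distribution \<mu>" "moment_series \<mu> = inverse (1 - fps_X * k)"
    by (rule algebraic_distribution_exists[of "inverse (1 - fps_X * k)"]) simp
  have "boolean_series \<mu> = k"
    by (rule boolean_series_unique[OF \<mu>(1)]) (simp add: \<mu>(2) inverse_mult_eq_1)
  with \<mu>(1) show ?thesis by (rule that)
qed

text \<open>With M the moment series of \<open>\<nu>'\<close>, M - 1 is z M times its boolean
  series, and B composed with z M is z M times the composed boolean series. The factor z M cancels
  from the defining equation of R.\<close>

lemma R_transform_eq_iff:
  assumes "algebraic_distribution \<nu>'" "algebraic_distribution \<nu>"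
  shows "R_transform \<nu>' = B_transform \<nu> \<longleftrightarrow>
    boolean_series \<nu>' = boolean_series \<nu> oo (fps_X * moment_series \<nu>')"
proof -
  let ?M = "moment_series \<nu>'" and ?k = "boolean_series \<nu>" and ?k' = "boolean_series \<nu>'"
  have nz: "?M \<noteq> 0"
    using moment_series_nth_0[OF assms(1)] by auto
  have "R_transform \<nu>' = r \<longleftrightarrow> ?M - 1 = r oo (fps_X * ?M)" for r
    unfolding R_transform_def
    using theI'[OF R_transform_ex1[OF assms(1) assms(1)]] the1_equality[OF R_transform_ex1[OF assms(1) assms(1)]]
    by metis
  also have "?M - 1 = ?M * fps_X * ?k'"
    using moment_series_boolean[OF assms(1)] by (simp add: algebra_simps)
  also have "B_transform \<nu> oo (fps_X * ?M) = ?M * fps_X * (?k oo (fps_X * ?M))"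
    by (simp add: B_transform_eq[OF assms(2)] fps_compose_mult_distrib mult.commute)
  finally show ?thesis
    using nz by simp
qed

text \<open>The same cancellation as for R, now with the common factor z L M, where L is the moment
  series of \<open>\<mu>'\<close>.\<close>

lemma cR_transform_eq_iff:
  assumes "algebraic_distribution \<mu>'" "algebraic_distribution \<nu>'" "algebraic_distribution \<mu>"
  shows "cR_transform \<mu>' \<nu>' = B_transform \<mu> \<longleftrightarrow>
    boolean_series \<mu>' = boolean_series \<mu> oo (fps_X * moment_series \<nu>')"
proof -
  let ?M = "moment_series \<nu>'" and ?L = "moment_series \<mu>'"
    and ?l = "boolean_series \<mu>" and ?l' = "boolean_series \<mu>'"
  have nz: "?M \<noteq> 0" "?L \<noteq> 0"
    using moment_series_nth_0[OF assms(1)] moment_series_nth_0[OF assms(2)] by auto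
  have "cR_transform \<mu>' \<nu>' = r \<longleftrightarrow> (?L - 1) * ?M = ?L * (r oo (fps_X * ?M))" for r
    unfolding cR_transform_def
    using theI'[OF cR_transform_ex1[OF assms(1,2)]] the1_equality[OF cR_transform_ex1[OF assms(1,2)]]
    by metis
  also have "?L - 1 = ?L * fps_X * ?l'"
    using moment_series_boolean[OF assms(1)] by (simp add: algebra_simps)
  also have "B_transform \<mu> oo (fps_X * ?M) = ?M * fps_X * (?l oo (fps_X * ?M))"
    by (simp add: B_transform_eq[OF assms(3)] fps_compose_mult_distrib mult.commute)
  finally show ?thesis
    using nz by simp
qed

text \<open>The series \<open>g\<close> is \<open>z M\<^bsub>\<nu>'\<^esub>(z)\<close>.\<close>

lemma BP_eq:
  assumes "algebraic_distribution \<mu>" "algebraic_distribution \<nu>"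
  obtains \<mu>' \<nu>' g where "BP (\<mu>, \<nu>) = (\<mu>', \<nu>')"
    "algebraic_distribution \<mu>'" "algebraic_distribution \<nu>'"
    "g = fps_X * (1 + (B_transform \<nu> oo g))"
    "boolean_series \<mu>' = boolean_series \<mu> oo g"
    "boolean_series \<nu>' = boolean_series \<nu> oo g"
proof -
  let ?F = "\<lambda>g. fps_X * (1 + (B_transform \<nu> oo g))"
  have contr: "fps_contraction ?F"
    by (rule fps_contraction_tree) simp
  obtain g where g: "?F g = g"
    using contr by (rule fps_contraction_fixed_point)
  have g0: "g $ 0 = 0"
    by (subst g[symmetric]) simp
  obtain \<mu>' \<nu>' where ad: "algebraic_distribution \<mu>'" "algebraic_distribution \<nu>'"
    and bs: "boolean_series \<mu>' = boolean_series \<mu> oo g"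
      "boolean_series \<nu>' = boolean_series \<nu> oo g"
    by (metis boolean_series_exists)
  have F: "?F h = fps_X * (1 + h * (boolean_series \<nu> oo h))" if "h $ 0 = 0" for h
    using that by (simp add: B_transform_eq[OF assms(2)] fps_compose_mult_distrib)
  \<comment> \<open>Once B is written as z k, the fixed point equation becomes linear in
    \<open>g\<close> and identifies \<open>g\<close> with z times the moment series of
    \<open>\<nu>'\<close>.\<close>
  have "g * (1 - fps_X * boolean_series \<nu>') = fps_X"
    using g F[OF g0] by (simp add: bs algebra_simps)
  hence gM: "g = fps_X * moment_series \<nu>'"
    using moment_series_boolean[OF ad(2)] by (metis mult.assoc mult.commute mult.right_neutral)
  let ?P = "\<lambda>(\<mu>', \<nu>'). algebraic_distribution \<mu>' \<and> algebraic_distribution \<nu>' \<and>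
     R_transform \<nu>' = B_transform \<nu> \<and> cR_transform \<mu>' \<nu>' = B_transform \<mu>"
  have "(THE p. ?P p) = (\<mu>', \<nu>')"
  proof (rule the_equality)
    show "?P (\<mu>', \<nu>')"
      using ad assms bs by (simp add: R_transform_eq_iff cR_transform_eq_iff flip: gM)
  next
    \<comment> \<open>For any other solution, z times its second moment series is a fixed point of
      the same contraction.\<close>
    fix p assume P: "?P p"
    obtain \<mu>'' \<nu>'' where p: "p = (\<mu>'', \<nu>'')" by (cases p)
    define h where "h = fps_X * moment_series \<nu>''"
    have ad': "algebraic_distribution \<mu>''" "algebraic_distribution \<nu>''"
      and bs': "boolean_series \<mu>'' = boolean_series \<mu> oo h" "boolean_series \<nu>'' = boolean_series \<nu> oo h"
      using P assms by (auto simp: p R_transform_eq_iff cR_transform_eq_iff h_def)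
    have "h = fps_X * (1 + h * boolean_series \<nu>'')"
      using moment_series_boolean[OF ad'(2)] by (simp add: h_def algebra_simps)
    hence "?F h = h"
      using F[of h] by (simp add: bs' h_def)
    hence "h = g"
      using fps_contraction_unique[OF contr] g by blast
    thus "p = (\<mu>', \<nu>')"
      using boolean_series_inject ad ad' bs bs' p by simp
  qed
  hence "BP (\<mu>, \<nu>) = (\<mu>', \<nu>')"
    by (simp add: BP_def)
  thus ?thesis using that ad g bs by metis
qed


section \<open>Power series over an algebra\<close>

lemma unital_subalgebraD:
  assumes "unital_subalgebra S"
  shows unital_subalgebra_one: "1 \<in> S"
    and unital_subalgebra_add: "x \<in> S \<Longrightarrow> y \<in> S \<Longrightarrow> x + y \<in> S"
    and unital_subalgebra_mult: "x \<in> S \<Longrightarrow> y \<in> S \<Longrightarrow> x * y \<in> S"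
    and unital_subalgebra_scaleC: "x \<in> S \<Longrightarrow> c *\<^sub>C x \<in> S"
  using assms by (auto simp: unital_subalgebra_def)

lemma unital_subalgebra_diff:
  assumes "unital_subalgebra S" "x \<in> S" "y \<in> S"
  shows "x - y \<in> S"
proof -
  have "(-1) *\<^sub>C y + 1 *\<^sub>C y = 0"
    by (simp flip: scaleC_add_left)
  hence "(-1) *\<^sub>C y = - y"
    by (simp add: scaleC_one eq_neg_iff_add_eq_0)
  thus ?thesis
    using unital_subalgebra_add[OF assms(1,2) unital_subalgebra_scaleC[OF assms(1,3), of "-1"]] by simp
qed

lemma unital_subalgebra_power:
  "unital_subalgebra S \<Longrightarrow> x \<in> S \<Longrightarrow> x ^ n \<in> S"
  by (induction n) (auto intro: unital_subalgebraD)

lemma unital_subalgebra_sum: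
  assumes "unital_subalgebra S" "\<And>i. i \<in> I \<Longrightarrow> f i \<in> S"
  shows "sum f I \<in> S"
proof -
  have "0 \<in> S"
    using unital_subalgebra_scaleC[OF assms(1) unital_subalgebra_one[OF assms(1)], of 0] by simp
  thus ?thesis
    using assms(2) by (induction I rule: infinite_finite_induct) (auto intro: unital_subalgebra_add[OF assms(1)])
qed

lemma generated_algebra_self: "X \<in> generated_algebra X"
  unfolding generated_algebra_def by (rule hull_inc) simp

lemma
  assumes "unital_functional \<phi>"
  shows unital_functional_add: "\<phi> (x + y) = \<phi> x + \<phi> y"
    and unital_functional_scaleC: "\<phi> (c *\<^sub>C x) = c * \<phi> x"
    and unital_functional_one: "\<phi> 1 = 1"
    and unital_functional_zero: "\<phi> 0 = 0"
    and unital_functional_diff: "\<phi> (x - y) = \<phi> x - \<phi> y"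
proof -
  show add: "\<phi> (x + y) = \<phi> x + \<phi> y" for x y
    using assms by (simp add: unital_functional_iff)
  show "\<phi> (c *\<^sub>C x) = c * \<phi> x" "\<phi> 1 = 1"
    using assms by (simp_all add: unital_functional_iff)
  show "\<phi> 0 = 0"
    using add[of 0 0] by simp
  show "\<phi> (x - y) = \<phi> x - \<phi> y"
    using add[of "x - y" y] by simp
qed

lemma unital_functional_sum:
  "unital_functional \<phi> \<Longrightarrow> \<phi> (sum f S) = (\<Sum>i\<in>S. \<phi> (f i))"
  by (induction S rule: infinite_finite_induct) (simp_all add: unital_functional_zero unital_functional_add)

text \<open>Scalar series act as central elements of the power series ring over a noncommutative
  algebra. Through \<open>fps_scale\<close> this ring becomes an algebra over the scalar series, and
  \<open>fps_functional\<close> is linear over them.\<close>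

definition fps_embed :: "complex fps \<Rightarrow> 'a::complex_algebra_1 fps" where
  "fps_embed c = Abs_fps (\<lambda>n. (c $ n) *\<^sub>C 1)"

definition fps_scale :: "complex fps \<Rightarrow> 'a::complex_algebra_1 fps \<Rightarrow> 'a fps" where
  "fps_scale c F = fps_embed c * F"

definition fps_functional :: "('a \<Rightarrow> complex) \<Rightarrow> 'a::complex_algebra_1 fps \<Rightarrow> complex fps" where
  "fps_functional \<phi> F = Abs_fps (\<lambda>n. \<phi> (F $ n))"

lemma scaleC_mult_one: "(a * b) *\<^sub>C (1::'a::complex_algebra_1) = (a *\<^sub>C 1) * (b *\<^sub>C 1)"
  by (simp add: mult_scaleC_left scaleC_scaleC)

lemma fps_scale_nth: "fps_scale c F $ n = (\<Sum>i=0..n. (c $ i) *\<^sub>C (F $ (n - i)))"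
  by (simp add: fps_scale_def fps_embed_def fps_mult_nth mult_scaleC_left)

lemma fps_embed_commute: "F * fps_embed c = fps_embed c * F"
proof (rule fps_ext)
  fix n
  have "(F * fps_embed c) $ n = (\<Sum>i=0..n. (c $ (n - i)) *\<^sub>C (F $ i))"
    by (simp add: fps_embed_def fps_mult_nth mult_scaleC_right)
  also have "\<dots> = (\<Sum>i=0..n. (c $ i) *\<^sub>C (F $ (n - i)))"
    by (rule sum.reindex_bij_witness[of _ "\<lambda>i. n - i" "\<lambda>i. n - i"]) auto
  finally show "(F * fps_embed c) $ n = (fps_embed c * F) $ n"
    by (simp add: fps_scale_nth flip: fps_scale_def)
qed

lemma scaleC_sum_left: "sum f S *\<^sub>C (x::'a::complex_algebra_1) = (\<Sum>i\<in>S. f i *\<^sub>C x)"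
  by (induction S rule: infinite_finite_induct) (simp_all add: scaleC_add_left)

lemma fps_embed_mult: "fps_embed (c * d) = fps_embed c * fps_embed d"
  by (rule fps_ext) (simp add: fps_embed_def fps_mult_nth scaleC_sum_left scaleC_mult_one)

lemma fps_embed_add: "fps_embed (c + d) = fps_embed c + fps_embed d"
  by (rule fps_ext) (simp add: fps_embed_def scaleC_add_left)

lemma fps_embed_one: "fps_embed 1 = 1"
  by (rule fps_ext) (simp add: fps_embed_def scaleC_one)

lemma fps_scale_one [simp]: "fps_scale 1 F = F"
  by (simp add: fps_scale_def fps_embed_one)

lemma fps_scale_scale: "fps_scale c (fps_scale d F) = fps_scale (c * d) F"
  by (simp add: fps_scale_def fps_embed_mult mult.assoc)

lemma fps_scale_add: "fps_scale c (F + G) = fps_scale c F + fps_scale c G"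
  by (simp add: fps_scale_def distrib_left)

lemma fps_scale_diff: "fps_scale c (F - G) = fps_scale c F - fps_scale c G"
  by (simp add: fps_scale_def right_diff_distrib)

lemma fps_scale_add_left: "fps_scale (c + d) F = fps_scale c F + fps_scale d F"
  by (simp add: fps_scale_def fps_embed_add distrib_right)

lemma fps_scale_diff_left: "fps_scale (c - d) F = fps_scale c F - fps_scale d F"
  using fps_scale_add_left[of "c - d" d F] by simp

lemma fps_scale_mult_left: "fps_scale c F * G = fps_scale c (F * G)"
  by (simp add: fps_scale_def mult.assoc)

lemma fps_scale_mult_right: "F * fps_scale c G = fps_scale c (F * G)"
  unfolding fps_scale_def by (metis fps_embed_commute mult.assoc)

lemmas fps_scale_simps = fps_scale_scale fps_scale_add fps_scale_diff fps_scale_mult_left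
  fps_scale_mult_right

context
  fixes \<phi> :: "'a::complex_algebra_1 \<Rightarrow> complex"
  assumes \<phi>: "unital_functional \<phi>"
begin

lemma fps_functional_add: "fps_functional \<phi> (F + G) = fps_functional \<phi> F + fps_functional \<phi> G"
  by (rule fps_ext) (simp add: fps_functional_def unital_functional_add[OF \<phi>])

lemma fps_functional_diff: "fps_functional \<phi> (F - G) = fps_functional \<phi> F - fps_functional \<phi> G"
  by (rule fps_ext) (simp add: fps_functional_def unital_functional_diff[OF \<phi>])

lemma fps_functional_scale: "fps_functional \<phi> (fps_scale c F) = c * fps_functional \<phi> F"
  by (rule fps_ext)
     (simp add: fps_functional_def fps_scale_nth fps_mult_nth unital_functional_sum[OF \<phi>]
       unital_functional_scaleC[OF \<phi>])

end

text \<open>This is the inverse of 1 - w X as a geometric series. When \<open>w\<close> has no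
  constant term, w^i contributes nothing to coefficient \<open>n\<close> for i > n, so the truncated
  sum is the full series.\<close>

definition resolvent :: "complex fps \<Rightarrow> 'a::complex_algebra_1 \<Rightarrow> 'a fps" where
  "resolvent w X = Abs_fps (\<lambda>n. \<Sum>i=0..n. ((w ^ i) $ n) *\<^sub>C X ^ i)"

lemma resolvent_nth:
  assumes "w $ 0 = 0" "n \<le> m"
  shows "resolvent w X $ n = (\<Sum>i=0..m. ((w ^ i) $ n) *\<^sub>C X ^ i)"
  unfolding resolvent_def fps_nth_Abs_fps
  by (rule sum.mono_neutral_left) (use assms in \<open>auto simp: startsby_zero_power_prefix\<close>)

lemma resolvent_eq:
  assumes "w $ 0 = 0"
  shows "resolvent w X = 1 + fps_scale w (fps_const X * resolvent w X)"
proof (rule fps_ext)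
  fix n
  have "(fps_scale w (fps_const X * resolvent w X)) $ n =
      (\<Sum>j=0..n. \<Sum>i=0..n. (w $ j * (w ^ i) $ (n - j)) *\<^sub>C X ^ Suc i)"
    by (simp add: fps_scale_nth resolvent_nth[OF assms, of _ n] scaleC_sum_right sum_distrib_left
        mult_scaleC_right scaleC_scaleC)
  also have "\<dots> = (\<Sum>i=0..n. ((w ^ Suc i) $ n) *\<^sub>C X ^ Suc i)"
    by (subst sum.swap) (simp add: fps_mult_nth scaleC_sum_left)
  also have "\<dots> = (\<Sum>i=1..Suc n. ((w ^ i) $ n) *\<^sub>C X ^ i)"
    by (rule sum.reindex_bij_witness[of _ "\<lambda>i. i - 1" Suc]) auto
  \<comment> \<open>The unit supplies the term \<open>i = 0\<close>; the surplus term
    \<open>i = Suc n\<close> is zero, as \<open>w\<close> starts in degree 1.\<close>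
  also have "(1 :: 'a fps) $ n + \<dots> = (\<Sum>i=0..Suc n. ((w ^ i) $ n) *\<^sub>C X ^ i)"
    by (subst sum.atLeast_Suc_atMost[of 0]) (simp_all add: scaleC_one del: sum.cl_ivl_Suc)
  also have "\<dots> = resolvent w X $ n"
    by (rule resolvent_nth[symmetric]) (use assms in auto)
  finally show "resolvent w X $ n = (1 + fps_scale w (fps_const X * resolvent w X)) $ n"
    by simp
qed

lemma fps_const_resolvent_commute: "resolvent w X * fps_const X = fps_const X * resolvent w X"
proof (rule fps_ext)
  fix n
  show "(resolvent w X * fps_const X) $ n = (fps_const X * resolvent w X) $ n"
    by (simp add: resolvent_def sum_distrib_left sum_distrib_right
        mult_scaleC_left mult_scaleC_right power_commutes)
qed

text \<open>Applied to the sum of w^i X^i, the functional gives the moment series at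
  \<open>w\<close>; a further factor \<open>X\<close> shifts the moments by one.\<close>

lemma fps_functional_resolvent:
  assumes "unital_functional \<phi>"
  shows "fps_functional \<phi> (resolvent w X) = Abs_fps (\<lambda>i. \<phi> (X ^ i)) oo w"
    and "fps_functional \<phi> (fps_const X * resolvent w X) = fps_shift 1 (Abs_fps (\<lambda>i. \<phi> (X ^ i))) oo w"
  by (rule fps_ext; simp add: fps_functional_def resolvent_def fps_compose_nth sum_distrib_left
      mult_scaleC_right unital_functional_sum[OF assms] unital_functional_scaleC[OF assms] mult.commute)+

lemma resolvent_fps_X_nth: "resolvent fps_X X $ n = X ^ n"
  by (simp add: resolvent_def fps_X_power_nth if_distrib if_distribR scaleC_one cong: if_cong)


section \<open>The distribution of a product of c-free elements\<close>

lemma aeval_eq_sum: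
  assumes "degree P \<le> n"
  shows "aeval P X = (\<Sum>i\<le>n. coeff P i *\<^sub>C X ^ i)"
  unfolding aeval_def
  by (rule sum.mono_neutral_left) (use assms in \<open>auto simp: coeff_eq_0\<close>)

lemma aeval_add: "aeval (P + Q) X = aeval P X + aeval Q X"
  by (simp add: aeval_eq_sum[of _ "max (degree P) (degree Q)"] degree_add_le
      scaleC_add_left sum.distrib)

lemma aeval_smult: "aeval (smult c P) X = c *\<^sub>C aeval P X"
  by (simp add: aeval_eq_sum[of "smult c P" "degree P"] degree_smult_le aeval_def
      scaleC_sum_right scaleC_scaleC)

lemma aeval_monom: "aeval (monom c n) X = c *\<^sub>C X ^ n"
  by (simp add: aeval_eq_sum[of _ n] degree_monom_le if_distrib if_distribR cong: if_cong)

lemma aeval_one: "aeval 1 X = 1"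
  using aeval_monom[of 1 0 X] by (simp add: scaleC_one)

lemma algebraic_distribution_aeval:
  assumes "unital_functional \<phi>"
  shows "algebraic_distribution (\<lambda>P. \<phi> (aeval P X))"
  using assms by (simp add: algebraic_distribution_iff aeval_add aeval_smult aeval_one
      unital_functional_add unital_functional_scaleC unital_functional_one)

lemma moment_series_aeval: "moment_series (\<lambda>P. \<phi> (aeval P X)) = Abs_fps (\<lambda>n. \<phi> (X ^ n))"
  by (simp add: moment_series_def aeval_monom scaleC_one)

text \<open>The relation M = 1 + z k M gives (M - 1)/z = k M; both claims are its forms after
  substituting \<open>w\<close> for z. The first one determines the constant that centres X times
  its resolvent.\<close>

lemma
  fixes X :: "'a::complex_algebra_1"
  assumes "unital_functional \<phi>" "w $ 0 = 0"
  defines "l \<equiv> boolean_series (\<lambda>P. \<phi> (aeval P X)) oo w"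
  shows fps_functional_mult_resolvent:
      "fps_functional \<phi> (fps_const X * resolvent w X) = l * fps_functional \<phi> (resolvent w X)"
    and fps_functional_resolvent_boolean:
      "fps_functional \<phi> (resolvent w X) * (1 - w * l) = 1"
proof -
  let ?M = "Abs_fps (\<lambda>i. \<phi> (X ^ i))" and ?b = "boolean_series (\<lambda>P. \<phi> (aeval P X))"
  have M: "?M * (1 - fps_X * ?b) = 1"
    using moment_series_boolean[OF algebraic_distribution_aeval[OF assms(1), of X]]
    by (simp add: moment_series_aeval)
  have "?M = 1 + fps_X * (?b * ?M)"
    using M by (simp add: algebra_simps)
  hence "fps_shift 1 ?M = fps_shift 1 (1 + fps_X * (?b * ?M))"
    by simp
  also have "\<dots> = ?b * ?M"
    by (rule fps_ext) simp
  finally show "fps_functional \<phi> (fps_const X * resolvent w X) = l * fps_functional \<phi> (resolvent w X)"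
    by (simp add: fps_functional_resolvent[OF assms(1)] l_def fps_compose_mult_distrib[OF assms(2)])
  have "(?M * (1 - fps_X * ?b)) oo w = 1"
    unfolding M by simp
  thus "fps_functional \<phi> (resolvent w X) * (1 - w * l) = 1"
    by (simp add: fps_functional_resolvent[OF assms(1)] l_def assms(2)
        fps_compose_mult_distrib[OF assms(2)] fps_compose_sub_distrib)
qed

text \<open>Swapping the two sets at each letter replaces the parity of the index in
  \<open>c_free\<close> and makes induction on the list possible.\<close>

primrec alternating :: "'a set \<Rightarrow> 'a set \<Rightarrow> 'a list \<Rightarrow> bool" where
  "alternating S T [] \<longleftrightarrow> True"
| "alternating S T (x # xs) \<longleftrightarrow> x \<in> S \<and> alternating T S xs"

lemma alternating_iff_nth:
  "alternating S T xs \<longleftrightarrow> (\<forall>i<length xs. xs ! i \<in> (if even i then S else T))"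
proof (induction xs arbitrary: S T)
  case (Cons x xs)
  show ?case
    unfolding alternating.simps Cons.IH by (auto simp: All_less_Suc2)
qed simp

lemma alternating_concat_replicate:
  "x \<in> S \<Longrightarrow> y \<in> T \<Longrightarrow> alternating S T zs \<Longrightarrow> alternating S T (concat (replicate n [x, y]) @ zs)"
  by (induction n) auto

lemma c_free_iff:
  "c_free \<theta> E X Y \<longleftrightarrow> (\<forall>As. As \<noteq> [] \<and>
     (alternating (generated_algebra X) (generated_algebra Y) As \<or>
      alternating (generated_algebra Y) (generated_algebra X) As) \<and>
     (\<forall>A\<in>set As. E A = 0) \<longrightarrow>
     E (prod_list As) = 0 \<and> \<theta> (prod_list As) = prod_list (map \<theta> As))"
proof -
  have "(As ! i \<in> generated_algebra (if even i = True then X else Y)) \<longleftrightarrow>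
      As ! i \<in> (if even i then generated_algebra X else generated_algebra Y)"
    "(As ! i \<in> generated_algebra (if even i = False then X else Y)) \<longleftrightarrow>
      As ! i \<in> (if even i then generated_algebra Y else generated_algebra X)" for As i
    by auto
  thus ?thesis
    unfolding c_free_def alternating_iff_nth all_bool_eq by blast
qed

lemma prod_list_eq_0: "0 \<in> set xs \<Longrightarrow> prod_list xs = (0::complex)"
  by (simp add: prod_list_zero_iff)

text \<open>This lets the product formula for first coordinates serve for second coordinates as
  well. All factors are centred and there is at least one, so the product of their E-values is
  0.\<close>

lemma c_free_diagonal:
  assumes "c_free \<theta> E X Y"
  shows "c_free E E X Y"
  unfolding c_free_iff
proof (intro allI impI conjI)
  fix As assume As: "As \<noteq> [] \<and> (alternating (generated_algebra X) (generated_algebra Y) As \<or>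
      alternating (generated_algebra Y) (generated_algebra X) As) \<and> (\<forall>A\<in>set As. E A = 0)"
  thus E: "E (prod_list As) = 0"
    using assms unfolding c_free_iff by blast
  have "0 \<in> set (map E As)"
    using As by (cases As) auto
  thus "E (prod_list As) = prod_list (map E As)"
    by (simp only: prod_list_eq_0 E)
qed

section \<open>From products of algebra elements to products of power series\<close>

definition fps_over :: "'a set \<Rightarrow> 'a::zero fps set" where
  "fps_over S = {F. \<forall>n. F $ n \<in> S}"

text \<open>Coefficients of a product are sums of alternating products of centred elements, on which
  \<open>\<psi>\<close> is multiplicative. The general additive \<open>\<psi>\<close> and the
  constant \<open>c\<close> serve the induction: left multiplication by a coefficient of the first
  series is absorbed into \<open>\<psi>\<close>, its value into \<open>c\<close>.\<close>

lemma fps_functional_prod_list: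
  fixes \<psi> \<phi> E :: "'a::complex_algebra_1 \<Rightarrow> complex"
  assumes "Modules.additive \<psi>"
    and "\<And>As. alternating S T As \<Longrightarrow> (\<forall>A\<in>set As. E A = 0) \<Longrightarrow>
      \<psi> (prod_list As) = c * prod_list (map \<phi> As)"
    and "alternating (fps_over S) (fps_over T) Fs" "\<forall>F\<in>set Fs. fps_functional E F = 0"
  shows "fps_functional \<psi> (prod_list Fs) = fps_const c * prod_list (map (fps_functional \<phi>) Fs)"
  using assms
proof (induction Fs arbitrary: \<psi> c S T)
  case Nil
  interpret Modules.additive \<psi> by fact
  show ?case
    using Nil.prems(2)[of "[]"] by (intro fps_ext) (simp add: fps_functional_def zero)
next
  case (Cons F Fs)
  interpret Modules.additive \<psi> by fact
  have F: "F $ i \<in> S" "E (F $ i) = 0" for i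
  proof -
    show "F $ i \<in> S" using Cons.prems(3) by (simp add: fps_over_def)
    have "fps_functional E F $ i = 0" using Cons.prems(4) by simp
    thus "E (F $ i) = 0" by (simp add: fps_functional_def)
  qed
  have IH: "fps_functional (\<lambda>x. \<psi> (F $ i * x)) (prod_list Fs) =
      fps_const (c * \<phi> (F $ i)) * prod_list (map (fps_functional \<phi>) Fs)" for i
  proof (rule Cons.IH)
    show "Modules.additive (\<lambda>x. \<psi> (F $ i * x))"
      by standard (simp add: distrib_left add)
    show "\<psi> (F $ i * prod_list As) = c * \<phi> (F $ i) * prod_list (map \<phi> As)"
      if "alternating T S As" "\<forall>A\<in>set As. E A = 0" for As
      using Cons.prems(2)[of "F $ i # As"] F that by simp
  qed (use Cons.prems in auto)
  show ?case
  proof (rule fps_ext)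
    fix n
    have "fps_functional \<psi> (prod_list (F # Fs)) $ n =
        (\<Sum>i=0..n. fps_functional (\<lambda>x. \<psi> (F $ i * x)) (prod_list Fs) $ (n - i))"
      by (simp add: fps_functional_def fps_mult_nth sum)
    also have "\<dots> = (fps_const c * prod_list (map (fps_functional \<phi>) (F # Fs))) $ n"
      by (simp only: IH list.map prod_list.Cons fps_mult_left_const_nth)
        (simp add: fps_mult_nth fps_functional_def sum_distrib_left mult.assoc)
    finally show "fps_functional \<psi> (prod_list (F # Fs)) $ n =
        (fps_const c * prod_list (map (fps_functional \<phi>) (F # Fs))) $ n" .
  qed
qed

text \<open>Iterating the equation for \<open>G\<close> yields the geometric series \<open>\<Sum>\<^sub>j z\<^sup>j (p q)\<^sup>j (1 + w p)\<close>.\<close>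

lemma fps_functional_geometric:
  fixes p q G :: "'a::complex_algebra_1 fps"
  assumes \<phi>: "unital_functional \<phi>"
    and G: "G = 1 + fps_scale w p + fps_scale fps_X (p * (q * G))"
    and even: "\<And>j. fps_functional \<phi> (a * (p * q) ^ j) = A * t ^ j"
    and odd: "\<And>j. fps_functional \<phi> (a * (p * q) ^ j * p) = A * t ^ j * P"
  shows "fps_functional \<phi> (a * G) * (1 - fps_X * t) = A * (1 + w * P)"
proof -
  define h where "h j = fps_functional \<phi> (a * (p * q) ^ j * G)" for j
  have step: "a * (p * q) ^ j * G = a * (p * q) ^ j + fps_scale w (a * (p * q) ^ j * p) +
      fps_scale fps_X (a * (p * q) ^ Suc j * G)" for j
    by (subst G) (simp only: distrib_left fps_scale_mult_right mult_1_right power_Suc2 mult.assoc)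
  have h: "h j = A * t ^ j * (1 + w * P) + fps_X * h (Suc j)" for j
  proof -
    have "h j = fps_functional \<phi> (a * (p * q) ^ j) + w * fps_functional \<phi> (a * (p * q) ^ j * p) +
        fps_X * h (Suc j)"
      using arg_cong[OF step[of j], of "fps_functional \<phi>"]
      by (simp only: h_def fps_functional_add[OF \<phi>] fps_functional_scale[OF \<phi>])
    thus ?thesis
      unfolding even odd by (simp add: algebra_simps)
  qed
  \<comment> \<open>\<open>d j\<close> is the defect of the closed form for \<open>h j\<close>.
    Since \<open>d j\<close> is \<open>fps_X\<close> times \<open>d (Suc j)\<close> for every
    \<open>j\<close>, all its coefficients vanish.\<close>
  define d where "d j = h j * (1 - fps_X * t) - A * t ^ j * (1 + w * P)" for j
  have d: "d j = fps_X * d (Suc j)" for j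
    unfolding d_def h[of j] by (simp add: algebra_simps)
  have "d j $ n = 0" for j n
  proof (induction n arbitrary: j)
    case (Suc n)
    thus ?case by (subst d) simp
  qed (subst d, simp)
  hence "d 0 = 0"
    by (intro fps_ext) simp
  thus ?thesis
    by (simp add: d_def h_def)
qed

lemma fps_over_resolvent:
  assumes "unital_subalgebra S" "X \<in> S"
  shows "fps_const X * resolvent w X - fps_scale c (resolvent w X) \<in> fps_over S"
proof -
  have r: "resolvent w X $ n \<in> S" for n
    unfolding resolvent_def fps_nth_Abs_fps using assms
    by (intro unital_subalgebra_sum unital_subalgebra_scaleC unital_subalgebra_power)
  show ?thesis
    unfolding fps_over_def using assms r
    by (auto simp: fps_scale_nth intro!: unital_subalgebra_diff unital_subalgebra_sum
        unital_subalgebra_scaleC unital_subalgebra_mult)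
qed

text \<open>The commutative end of the product formula, with \<open>g0\<close> and \<open>g1\<close>
  standing for the values of \<open>G\<close> and \<open>q * G\<close>. Multiplying by
  \<open>d1 * d2\<close> clears the denominators; what remains is the factorisation stated for
  \<open>boolean_series_mult_c_free\<close>, with the scalars \<open>L1\<close>, \<open>L2\<close>
  in place of \<open>X\<close>, \<open>Y\<close>.\<close>

lemma boolean_product_identity:
  fixes z K1 K2 L1 L2 M P Q m1 m2 g0 g1 w1 w2 :: "'a::idom"
  assumes w: "w1 = z * K2" "w2 = z * K1" and nz: "1 - z * K1 * K2 \<noteq> 0"
    and M: "(1 - z * K1 * K2) * M = g0 + w2 * g1"
    and g: "g0 * (1 - z * (P * Q)) = 1 + w1 * P" "g1 * (1 - z * (P * Q)) = Q * (1 + w1 * P)"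
    and m: "m1 * (1 - w1 * L1) = 1" "m2 * (1 - w2 * L2) = 1"
    and PQ: "P = (L1 - K1) * m1" "Q = (L2 - K2) * m2"
  shows "M * (1 - z * (L1 * L2)) = 1"
proof -
  define e d1 d2 where "e = 1 - z * K1 * K2" and "d1 = 1 - w1 * L1" and "d2 = 1 - w2 * L2"
  have Pd: "P * d1 = L1 - K1" "Q * d2 = L2 - K2"
    using m by (simp_all add: PQ d1_def d2_def mult.assoc)
  have "e * M * (1 - z * (P * Q)) = g0 * (1 - z * (P * Q)) + w2 * (g1 * (1 - z * (P * Q)))"
    unfolding e_def M by (simp only: distrib_right mult.assoc)
  also have "\<dots> = (1 + w1 * P) * (1 + w2 * Q)"
    unfolding g by (simp add: algebra_simps)
  finally have *: "e * M * (1 - z * (P * Q)) = (1 + w1 * P) * (1 + w2 * Q)" .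
  have e: "(1 + w1 * P) * d1 = e" "(1 + w2 * Q) * d2 = e"
  proof -
    have "(1 + w1 * P) * d1 = d1 + w1 * (P * d1)" "(1 + w2 * Q) * d2 = d2 + w2 * (Q * d2)"
      by (simp_all add: algebra_simps)
    thus "(1 + w1 * P) * d1 = e" "(1 + w2 * Q) * d2 = e"
      unfolding Pd by (simp_all add: d1_def d2_def e_def w algebra_simps)
  qed
  have "e * (M * (d1 * d2 - z * (P * d1) * (Q * d2))) = e * M * (1 - z * (P * Q)) * (d1 * d2)"
    by (simp add: algebra_simps)
  also have "\<dots> = ((1 + w1 * P) * d1) * ((1 + w2 * Q) * d2)"
    unfolding * by (simp add: algebra_simps)
  finally have "M * (d1 * d2 - z * (L1 - K1) * (L2 - K2)) = e"
    using nz unfolding Pd e by (simp add: e_def)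
  moreover have "d1 * d2 - z * (L1 - K1) * (L2 - K2) = e * (1 - z * (L1 * L2))"
    by (simp add: d1_def d2_def e_def w algebra_simps)
  ultimately have "M * (e * (1 - z * (L1 * L2))) = e"
    by simp
  hence "e * (M * (1 - z * (L1 * L2))) = e * 1"
    by (simp only: mult.left_commute mult_1_right)
  thus ?thesis
    using nz unfolding e_def[symmetric] by (simp only: mult_cancel_left simp_thms)
qed

text \<open>
  With the resolvents \<open>U = (1 - w\<^sub>1 X)\<^sup>-\<^sup>1\<close> and \<open>V = (1 - w\<^sub>2 Y)\<^sup>-\<^sup>1\<close>, the
  coefficients of \<open>p = (X - K\<^sub>1) U\<close> and \<open>q = (Y - K\<^sub>2) V\<close> are centred, and
  \<open>(1 - z K\<^sub>1 K\<^sub>2) (1 - z X Y) = (1 - w\<^sub>1 X) (1 - z p q) (1 - w\<^sub>2 Y)\<close>.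
\<close>

lemma boolean_series_mult_c_free:
  fixes X Y :: "'a::complex_algebra_1"
  assumes \<phi>: "unital_functional \<phi>" and E: "unital_functional E" and cf: "c_free \<phi> E X Y"
    and w: "w1 = fps_X * (boolean_series (\<lambda>P. E (aeval P Y)) oo w2)"
      "w2 = fps_X * (boolean_series (\<lambda>P. E (aeval P X)) oo w1)"
  shows "boolean_series (\<lambda>P. \<phi> (aeval P (X * Y))) =
    (boolean_series (\<lambda>P. \<phi> (aeval P X)) oo w1) * (boolean_series (\<lambda>P. \<phi> (aeval P Y)) oo w2)"
proof -
  define K1 where "K1 = boolean_series (\<lambda>P. E (aeval P X)) oo w1"
  define K2 where "K2 = boolean_series (\<lambda>P. E (aeval P Y)) oo w2"
  define L1 where "L1 = boolean_series (\<lambda>P. \<phi> (aeval P X)) oo w1"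
  define L2 where "L2 = boolean_series (\<lambda>P. \<phi> (aeval P Y)) oo w2"
  define x y where "x = fps_const X" and "y = fps_const Y"
  define U V W where "U = resolvent w1 X" and "V = resolvent w2 Y" and "W = resolvent fps_X (X * Y)"
  \<comment> \<open>\<open>G\<close> is (1 - w2 Y) W. This removes the right factor of the
    factorisation, so that \<open>G\<close> obeys a recursion in \<open>p\<close> and
    \<open>q\<close> alone.\<close>
  define p q G where "p = x * U - fps_scale K1 U" and "q = y * V - fps_scale K2 V"
    and "G = W - fps_scale w2 (y * W)"
  define e where "e = 1 - fps_X * K1 * K2"
  have w': "w1 = fps_X * K2" "w2 = fps_X * K1"
    using w by (simp_all add: K1_def K2_def)
  have w0: "w1 $ 0 = 0" "w2 $ 0 = 0"
    by (simp_all add: w')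
  have U: "U = 1 + fps_scale w1 (x * U)" and V: "V = 1 + fps_scale w2 (y * V)"
    and W: "W = 1 + fps_scale fps_X (x * (y * W))"
    using resolvent_eq[OF w0(1), of X] resolvent_eq[OF w0(2), of Y] resolvent_eq[of fps_X "X * Y"]
    by (simp_all add: U_def V_def W_def x_def y_def mult.assoc flip: fps_const_mult)
  have comm: "U * x = x * U" "V * y = y * V"
    by (simp_all add: U_def V_def x_def y_def fps_const_resolvent_commute)
  \<comment> \<open>The resolvent equation makes \<open>U\<close> a right inverse of 1 - w1 X; since
    \<open>U\<close> commutes with \<open>x\<close>, it is a left inverse too.\<close>
  have UH: "U * (H - fps_scale w1 (x * H)) = H" for H
  proof -
    have "U * (H - fps_scale w1 (x * H)) = (U - fps_scale w1 (x * U)) * H"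
      by (simp add: right_diff_distrib left_diff_distrib fps_scale_simps comm flip: mult.assoc)
    also have "U - fps_scale w1 (x * U) = 1"
      using U by (simp add: algebra_simps)
    finally show ?thesis by simp
  qed
  have VG: "V * G = W"
  proof -
    have "V * G = (V - fps_scale w2 (y * V)) * W"
      by (simp add: G_def right_diff_distrib left_diff_distrib fps_scale_simps comm flip: mult.assoc)
    also have "V - fps_scale w2 (y * V) = 1"
      using V by (simp add: algebra_simps)
    finally show ?thesis by simp
  qed
  have qG: "q * G = y * W - fps_scale K2 W"
    by (simp add: q_def left_diff_distrib fps_scale_simps VG mult.assoc)
  \<comment> \<open>Both \<open>w1 * K1\<close> and \<open>w2 * K2\<close> equal z K1 K2, so
    \<open>e\<close> is 1 - w1 K1 as well as 1 - w2 K2.\<close>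
  have eU: "fps_scale e U = 1 + fps_scale w1 p"
  proof -
    have "1 + fps_scale w1 p = 1 + fps_scale w1 (x * U) - fps_scale (w1 * K1) U"
      by (simp add: p_def fps_scale_simps)
    thus ?thesis
      unfolding U[symmetric] by (simp add: e_def fps_scale_diff_left w' mult_ac)
  qed
  have eV: "fps_scale e V = 1 + fps_scale w2 q"
  proof -
    have "1 + fps_scale w2 q = 1 + fps_scale w2 (y * V) - fps_scale (w2 * K2) V"
      by (simp add: q_def fps_scale_simps)
    thus ?thesis
      unfolding V[symmetric] by (simp add: e_def fps_scale_diff_left w' mult_ac)
  qed
  have G: "G = 1 + fps_scale w1 p + fps_scale fps_X (p * (q * G))"
  proof -
    let ?H = "x * (q * G) - fps_scale K1 (q * G)"
    have one: "1 = W - fps_scale fps_X (x * (y * W))"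
      using W by (simp add: algebra_simps)
    \<comment> \<open>This is the factorisation: (1 - w1 X)(1 - w2 Y) W = e + z (X - K1)(Y - K2) W.
      Multiplying by \<open>U\<close> from the left gives the recursion.\<close>
    have "G - fps_scale w1 (x * G) = fps_scale e 1 + fps_scale fps_X ?H"
      unfolding qG unfolding G_def e_def w' one
      by (simp add: fps_scale_simps fps_scale_diff_left algebra_simps)
    hence "G = U * (fps_scale e 1 + fps_scale fps_X ?H)"
      using UH[of G] by simp
    also have "\<dots> = fps_scale e U + fps_scale fps_X (p * (q * G))"
      by (simp add: p_def distrib_left right_diff_distrib left_diff_distrib fps_scale_simps comm
          flip: mult.assoc)
    finally show ?thesis
      by (simp only: eU)
  qed
  have eW: "fps_scale e W = G + fps_scale w2 (q * G)"
  proof -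
    have "fps_scale e W = fps_scale e V * G"
      by (simp add: fps_scale_simps VG)
    thus ?thesis
      by (simp add: eV distrib_right fps_scale_simps)
  qed

  let ?A = "generated_algebra X" and ?B = "generated_algebra Y"
  note functional = fps_functional_mult_resolvent fps_functional_diff fps_functional_scale
  have over: "p \<in> fps_over ?A" "q \<in> fps_over ?B"
    unfolding p_def q_def x_def y_def U_def V_def
    by (rule fps_over_resolvent[OF unital_subalgebra_generated generated_algebra_self])+
  \<comment> \<open>This fixes the choice of \<open>K1\<close> and \<open>K2\<close>: E applied to
    \<open>x * U\<close> is \<open>K1\<close> times E applied to \<open>U\<close>, and likewise for
    \<open>y * V\<close>.\<close>
  have centred: "fps_functional E p = 0" "fps_functional E q = 0"
    by (simp_all add: p_def q_def x_def y_def U_def V_def K1_def K2_def functional E w0)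
  define P Q where "P = fps_functional \<phi> p" and "Q = fps_functional \<phi> q"
  have PQ: "P = (L1 - K1) * fps_functional \<phi> U" "Q = (L2 - K2) * fps_functional \<phi> V"
    by (simp_all add: P_def Q_def p_def q_def x_def y_def U_def V_def L1_def L2_def functional \<phi> w0
        left_diff_distrib)
  have add: "Modules.additive \<phi>"
    by standard (rule unital_functional_add[OF \<phi>])
  \<comment> \<open>The empty word is excluded from \<open>c_free\<close>; it is covered by
    \<open>\<phi> 1 = 1\<close>.\<close>
  have mult: "\<phi> (prod_list As) = 1 * prod_list (map \<phi> As)"
    if "alternating ?A ?B As \<or> alternating ?B ?A As" "\<forall>A\<in>set As. E A = 0" for As
    using cf that unital_functional_one[OF \<phi>] unfolding c_free_iff by (cases "As = []") auto
  have alt: "fps_functional \<phi> (prod_list Fs) = prod_list (map (fps_functional \<phi>) Fs)"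
    if "alternating (fps_over ?A) (fps_over ?B) Fs \<or> alternating (fps_over ?B) (fps_over ?A) Fs"
      "set Fs \<subseteq> {p, q}" for Fs
  proof -
    have E0: "\<forall>F\<in>set Fs. fps_functional E F = 0"
      using that(2) centred by auto
    have "fps_functional \<phi> (prod_list Fs) = fps_const 1 * prod_list (map (fps_functional \<phi>) Fs)"
      using that(1)
    proof (elim disjE)
      assume a: "alternating (fps_over ?A) (fps_over ?B) Fs"
      show ?thesis by (rule fps_functional_prod_list[OF add _ a E0]) (use mult in blast)
    next
      assume a: "alternating (fps_over ?B) (fps_over ?A) Fs"
      show ?thesis by (rule fps_functional_prod_list[OF add _ a E0]) (use mult in blast)
    qed
    thus ?thesis by simp
  qed
  have prod: "prod_list (concat (replicate j [f, g])) = (f * g) ^ j" for f g :: "'b::monoid_mult" and j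
    by (induction j) (simp_all add: mult.assoc)
  have set: "set (concat (replicate j [p, q])) \<subseteq> {p, q}" for j
    by (induction j) auto
  have alts: "alternating (fps_over ?A) (fps_over ?B) (concat (replicate j [p, q]))"
    "alternating (fps_over ?A) (fps_over ?B) (concat (replicate j [p, q]) @ [p])" for j
    using alternating_concat_replicate[OF over, of "[]"] alternating_concat_replicate[OF over, of "[p]"] over
    by auto
  note map_concat [simp del]
  have map: "map (fps_functional \<phi>) (concat (replicate j [p, q])) = concat (replicate j [P, Q])" for j
    by (induction j) (simp_all add: P_def Q_def)
  \<comment> \<open>The geometric series is evaluated with prefix 1 and then with prefix
    \<open>q\<close>. In both cases all words that occur alternate in \<open>p\<close> and
    \<open>q\<close>.\<close>
  have "fps_functional \<phi> (1 * G) * (1 - fps_X * (P * Q)) = 1 * (1 + w1 * P)"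
    using alt[of "concat (replicate _ [p, q])"] alt[of "concat (replicate _ [p, q]) @ [p]"] alts set
    by (intro fps_functional_geometric[OF \<phi> G]) (simp_all add: prod map P_def[symmetric])
  moreover have "fps_functional \<phi> (q * G) * (1 - fps_X * (P * Q)) = Q * (1 + w1 * P)"
    using alt[of "q # concat (replicate _ [p, q])"] alt[of "q # concat (replicate _ [p, q]) @ [p]"] alts set over
    by (intro fps_functional_geometric[OF \<phi> G])
      (simp_all add: prod map P_def[symmetric] Q_def[symmetric] mult.assoc)
  moreover have "e * fps_functional \<phi> W = fps_functional \<phi> G + w2 * fps_functional \<phi> (q * G)"
    using arg_cong[OF eW, of "fps_functional \<phi>"]
    by (simp add: fps_functional_add[OF \<phi>] fps_functional_scale[OF \<phi>])
  moreover have "e \<noteq> 0"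
    by (rule fps_nonzeroI[of _ 0]) (simp add: e_def)
  moreover have "fps_functional \<phi> U * (1 - w1 * L1) = 1" "fps_functional \<phi> V * (1 - w2 * L2) = 1"
    by (simp_all add: U_def V_def L1_def L2_def fps_functional_resolvent_boolean[OF \<phi>] w0)
  ultimately have "fps_functional \<phi> W * (1 - fps_X * (L1 * L2)) = 1"
    using w' PQ unfolding e_def by (intro boolean_product_identity[of w1 fps_X K2 w2 K1]) simp_all
  moreover have "fps_functional \<phi> W = moment_series (\<lambda>P. \<phi> (aeval P (X * Y)))"
    by (simp add: W_def moment_series_aeval fps_functional_def resolvent_fps_X_nth)
  ultimately show ?thesis
    using boolean_series_unique[OF algebraic_distribution_aeval[OF \<phi>]] by (simp add: L1_def L2_def)
qed


section \<open>Existence of c-free realizations\<close>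

lemma aeval_pCons: "aeval (pCons a P) X = a *\<^sub>C 1 + X * aeval P X"
proof -
  have "aeval (pCons a P) X = (\<Sum>i\<le>Suc (degree P). coeff (pCons a P) i *\<^sub>C X ^ i)"
    by (rule aeval_eq_sum) (rule degree_pCons_le)
  thus ?thesis
    by (simp only: sum.atMost_Suc_shift aeval_def)
      (simp add: sum_distrib_left mult_scaleC_right)
qed

lemma aeval_0: "aeval 0 X = 0"
  by (simp add: aeval_def)

lemma aeval_mult: "aeval (P * Q) X = aeval P X * aeval Q X"
proof (induction P)
  case (pCons a P)
  have "aeval (pCons a P * Q) X = a *\<^sub>C aeval Q X + X * aeval (P * Q) X"
    by (simp add: aeval_add aeval_smult aeval_pCons)
  thus ?case
    by (simp add: pCons.IH aeval_pCons distrib_right mult_scaleC_left mult.assoc)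
qed (simp add: aeval_0)

lemma generated_algebra_imp_aeval:
  assumes "A \<in> generated_algebra X"
  obtains P where "A = aeval P X"
proof -
  have "unital_subalgebra (range (\<lambda>P. aeval P X))"
    unfolding unital_subalgebra_def
  proof (intro conjI ballI allI)
    show "1 \<in> range (\<lambda>P. aeval P X)"
      using aeval_one by (metis rangeI)
  qed (auto simp flip: aeval_add aeval_mult aeval_smult)
  moreover have "X = aeval (monom 1 1) X"
    by (simp add: aeval_monom scaleC_one)
  ultimately have "generated_algebra X \<subseteq> range (\<lambda>P. aeval P X)"
    unfolding generated_algebra_def by (intro hull_minimal) blast+
  thus ?thesis using assms that by blast
qed

text \<open>
  In the free product of the algebras of polynomials in \<open>x\<^sub>T\<close> and \<open>x\<^sub>F\<close>, the alternating words
  in the centred elements \<open>x\<^sub>g\<^sup>i - m g i\<close> with \<open>i \<ge> 1\<close> form a basis. Such a word is encoded by the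
  list of its pairs \<open>(g, i)\<close>, and \<open>letter_action m g\<close> is the transpose of the left
  multiplication by \<open>x\<^sub>g\<close>, acting on functionals given by their values on the basis. Lists that
  are not alternating do not encode a basis word; their values do not matter.
\<close>

type_synonym word_functional = "(bool \<times> nat) list \<Rightarrow> complex"

definition starts_with :: "bool \<Rightarrow> (bool \<times> nat) list \<Rightarrow> bool" where
  "starts_with g v \<longleftrightarrow> v \<noteq> [] \<and> fst (hd v) = g"

text \<open>In the first case x_g (x_g^i - m_i) = (x_g^(i+1) - m_(i+1)) + m_(i+1) - m_i ((x_g - m_1)
  + m_1), expanded in the basis. In the second case x_g = (x_g - m_1) + m_1 opens a new
  block.\<close>

definition letter_action ::
  "(bool \<Rightarrow> nat \<Rightarrow> complex) \<Rightarrow> bool \<Rightarrow> word_functional \<Rightarrow> word_functional" where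
  "letter_action m g L v =
    (if starts_with g v
     then L ((g, Suc (snd (hd v))) # tl v) + m g (Suc (snd (hd v))) * L (tl v)
       - m g (snd (hd v)) * (L ((g, 1) # tl v) + m g 1 * L (tl v))
     else L ((g, 1) # v) + m g 1 * L v)"

text \<open>Transposition reverses products: the functional v to L(x y v) arises from L by applying
  the transpose of x first. Hence \<open>fold\<close> starts with the leftmost letter.\<close>

definition word_action ::
  "(bool \<Rightarrow> nat \<Rightarrow> complex) \<Rightarrow> bool list \<Rightarrow> word_functional \<Rightarrow> word_functional" where
  "word_action m w = fold (letter_action m) w"

definition algebra_action ::
  "(bool \<Rightarrow> nat \<Rightarrow> complex) \<Rightarrow> free_algebra2 \<Rightarrow> word_functional \<Rightarrow> word_functional" where
  "algebra_action m f L v =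
    (\<Sum>w\<in>Poly_Mapping.keys f. Poly_Mapping.lookup f w * word_action m (letters w) L v)"

definition generator :: "bool \<Rightarrow> free_algebra2" where
  "generator g = Poly_Mapping.single (Word [g]) 1"

section \<open>The right action of the free algebra on functionals\<close>

lemma word_action_linear:
  "word_action m w (\<lambda>v. a * K v + b * L v) = (\<lambda>v. a * word_action m w K v + b * word_action m w L v)"
  unfolding word_action_def
proof (induction w arbitrary: K L)
  case (Cons g w)
  have "letter_action m g (\<lambda>v. a * K v + b * L v) =
      (\<lambda>v. a * letter_action m g K v + b * letter_action m g L v)"
    by (rule ext) (simp add: letter_action_def algebra_simps)
  thus ?case by (simp add: Cons.IH)
qed simp

lemma algebra_action_superset:
  assumes "finite S" "Poly_Mapping.keys f \<subseteq> S"
  shows "algebra_action m f L v = (\<Sum>w\<in>S. Poly_Mapping.lookup f w * word_action m (letters w) L v)"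
  unfolding algebra_action_def
  by (rule sum.mono_neutral_left) (use assms in \<open>auto simp: in_keys_iff\<close>)

lemma algebra_action_add:
  "algebra_action m (f + g) L v = algebra_action m f L v + algebra_action m g L v"
  using Poly_Mapping.keys_add[of f g]
  by (simp add: algebra_action_superset[of "Poly_Mapping.keys f \<union> Poly_Mapping.keys g"]
      lookup_add distrib_right sum.distrib)

lemma algebra_action_zero: "algebra_action m 0 L v = 0"
  by (simp add: algebra_action_def)

lemma algebra_action_sum: "algebra_action m (sum f S) L v = (\<Sum>i\<in>S. algebra_action m (f i) L v)"
  by (induction S rule: infinite_finite_induct) (simp_all add: algebra_action_zero algebra_action_add)

lemma algebra_action_single:
  "algebra_action m (Poly_Mapping.single w c) L v = c * word_action m (letters w) L v"
  by (subst algebra_action_superset[of "{w}"]) (auto simp: lookup_single)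

lemma algebra_action_one: "algebra_action m 1 L = L"
  using algebra_action_single[of m 0 1 L]
  by (intro ext) (simp add: zero_word_def word_action_def flip: single_one)

lemma algebra_action_scaleC: "algebra_action m (c *\<^sub>C f) L v = c * algebra_action m f L v"
  by (induction f rule: poly_mapping_add_induct)
    (simp_all add: algebra_action_zero algebra_action_add algebra_action_single scaleC_single
      scaleC_add_right scaleC_complex_def distrib_left mult.assoc)

lemma algebra_action_linear:
  "algebra_action m f (\<lambda>v. a * K v + b * L v) v = a * algebra_action m f K v + b * algebra_action m f L v"
  by (simp add: algebra_action_def word_action_linear distrib_left sum.distrib sum_distrib_left
      mult.left_commute)

lemma algebra_action_mult: "algebra_action m (f * g) L = algebra_action m g (algebra_action m f L)"
proof
  fix v
  show "algebra_action m (f * g) L v = algebra_action m g (algebra_action m f L) v"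
  proof (induction f rule: poly_mapping_add_induct)
    case zero
    \<comment> \<open>The zero functional is written as a linear combination so that linearity of
      the action applies to it.\<close>
    have "algebra_action m g (\<lambda>v. 0 * L v + 0 * L v) v = 0"
      by (simp only: algebra_action_linear) simp
    moreover have "algebra_action m 0 L = (\<lambda>v. 0 * L v + 0 * L v)"
      by (rule ext) (simp add: algebra_action_zero)
    ultimately show ?case by (simp add: algebra_action_zero)
  next
    case (single w c)
    have *: "algebra_action m (Poly_Mapping.single w c) L =
        (\<lambda>v. c * word_action m (letters w) L v + 0 * L v)"
      by (rule ext) (simp add: algebra_action_single)
    show ?case
    proof (induction g rule: poly_mapping_add_induct)
      case (single w' d)
      show ?case
        unfolding * algebra_action_linear
        by (simp add: mult_single algebra_action_single plus_word_def word_action_def mult.assoc)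
    qed (simp_all add: algebra_action_zero algebra_action_add distrib_left)
  next
    case (add f1 f2)
    have "algebra_action m (f1 + f2) L =
        (\<lambda>v. 1 * algebra_action m f1 L v + 1 * algebra_action m f2 L v)"
      by (rule ext) (simp add: algebra_action_add)
    thus ?case
      by (simp only: algebra_action_linear) (simp add: distrib_right algebra_action_add add)
  qed
qed

text \<open>On a word not starting with \<open>g\<close>, x_g^i splits into its centred part and
  \<open>m g i\<close>. For \<open>i = 0\<close> the centred part is 0 and \<open>(g, 0)\<close>
  encodes no letter, hence the case distinction.\<close>

lemma algebra_action_generator_power:
  assumes "m g 0 = 1" "\<not> starts_with g v"
  shows "algebra_action m (generator g ^ i) L v = (if i = 0 then 0 else L ((g, i) # v)) + m g i * L v"
proof (induction i arbitrary: L)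
  case 0
  show ?case using assms by (simp add: algebra_action_one)
next
  case (Suc i)
  have "algebra_action m (generator g) L = letter_action m g L"
    by (rule ext) (simp add: generator_def algebra_action_single word_action_def)
  hence "algebra_action m (generator g ^ Suc i) L v =
      (if i = 0 then 0 else letter_action m g L ((g, i) # v)) + m g i * letter_action m g L v"
    by (simp add: algebra_action_mult Suc.IH)
  \<comment> \<open>The terms subtracted in \<open>letter_action\<close> cancel against
    \<open>m g i * letter_action m g L v\<close>.\<close>
  thus ?case
    using assms by (auto simp: letter_action_def starts_with_def algebra_simps)
qed

lemma algebra_action_aeval:
  assumes "m g 0 = 1" "\<not> starts_with g v"
  shows "algebra_action m (aeval P (generator g)) L v =
    (\<Sum>i\<le>degree P. coeff P i * ((if i = 0 then 0 else L ((g, i) # v)) + m g i * L v))"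
  by (simp add: aeval_def algebra_action_sum algebra_action_scaleC
      algebra_action_generator_power[of m, OF assms])

text \<open>The value at the unit, encoded by the empty list, of the functional that is
  multiplicative on basis words, with \<open>c g i\<close> the value of x_g^i - m g i. For
  \<open>c = 0\<close> this is the free product functional, which kills every nonempty basis
  word.\<close>

definition product_functional ::
  "(bool \<Rightarrow> nat \<Rightarrow> complex) \<Rightarrow> (bool \<Rightarrow> nat \<Rightarrow> complex) \<Rightarrow> free_algebra2 \<Rightarrow> complex" where
  "product_functional m c f = algebra_action m f (\<lambda>v. prod_list (map (case_prod c) v)) []"

lemma unital_functional_product: "unital_functional (product_functional m c)"
  by (simp add: unital_functional_iff product_functional_def algebra_action_add
      algebra_action_scaleC algebra_action_one)

lemma product_functional_aeval:
  assumes "m g 0 = 1"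
  shows "product_functional m c (aeval P (generator g)) =
    (\<Sum>i\<le>degree P. coeff P i * ((if i = 0 then 0 else c g i) + m g i))"
  unfolding product_functional_def
  by (subst algebra_action_aeval[of m, OF assms])
    (auto simp: starts_with_def intro!: sum.cong)

text \<open>Acting by a centred \<open>A\<close> in x_g on a word not starting with \<open>g\<close>
  only prepends letters, because the term in \<open>L v\<close> has the mean of \<open>A\<close> as
  its coefficient. So \<open>L\<close> has to be controlled only on words that do not start with the
  other generator, and \<open>a\<close> collects the values of the factors already
  processed.\<close>

lemma algebra_action_alternating:
  fixes c :: "bool \<Rightarrow> nat \<Rightarrow> complex"
  defines "\<Lambda> \<equiv> \<lambda>v. prod_list (map (case_prod c) v)"
  assumes m: "\<And>g. m g 0 = 1"
    and "alternating (generated_algebra (generator g)) (generated_algebra (generator (\<not> g))) As"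
    and "\<forall>A\<in>set As. product_functional m (\<lambda>_ _. 0) A = 0"
    and "\<And>v. \<not> starts_with (\<not> g) v \<Longrightarrow> L v = a * \<Lambda> v"
  shows "algebra_action m (prod_list As) L [] = a * prod_list (map (product_functional m c) As)"
  using assms(3-)
proof (induction As arbitrary: g L a)
  case Nil
  have "L [] = a"
    using Nil.prems(3)[of "[]"] by (simp add: starts_with_def \<Lambda>_def)
  thus ?case by (simp add: algebra_action_one)
next
  case (Cons A As)
  obtain P where A: "A = aeval P (generator g)"
    using Cons.prems(1) by (auto elim: generated_algebra_imp_aeval)
  have "product_functional m (\<lambda>_ _. 0) A = 0"
    using Cons.prems(2) by simp
  hence centred: "(\<Sum>i\<le>degree P. coeff P i * m g i) = 0"
    by (simp add: A product_functional_aeval[of m, OF m])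
  let ?s = "\<Sum>i\<le>degree P. coeff P i * (if i = 0 then 0 else c g i)"
  have "product_functional m c A = ?s + (\<Sum>i\<le>degree P. coeff P i * m g i)"
    by (simp only: A product_functional_aeval[of m, OF m] distrib_left sum.distrib)
  hence \<phi>A: "product_functional m c A = ?s"
    by (simp only: centred add_0_right)
  have step: "algebra_action m A L v = a * product_functional m c A * \<Lambda> v" if v: "\<not> starts_with g v" for v
  proof -
    have L: "L ((g, i) # v) = a * (c g i * \<Lambda> v)" for i
      using Cons.prems(3)[of "(g, i) # v"] by (simp add: starts_with_def \<Lambda>_def)
    have "algebra_action m A L v = (\<Sum>i\<le>degree P. coeff P i * (if i = 0 then 0 else L ((g, i) # v)))
        + (\<Sum>i\<le>degree P. coeff P i * m g i) * L v"
      unfolding A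
      by (subst algebra_action_aeval[of m, OF m v])
        (simp only: distrib_left sum.distrib sum_distrib_right mult.assoc)
    also have "\<dots> = (\<Sum>i\<le>degree P. coeff P i * (if i = 0 then 0 else c g i) * (a * \<Lambda> v))"
      unfolding centred by (auto simp: L intro!: sum.cong)
    also have "\<dots> = a * ?s * \<Lambda> v"
      by (simp add: sum_distrib_left sum_distrib_right mult_ac)
    finally show ?thesis unfolding \<phi>A .
  qed
  have "algebra_action m (prod_list As) (algebra_action m A L) [] =
      a * product_functional m c A * prod_list (map (product_functional m c) As)"
    by (rule Cons.IH[of "\<not> g"]) (use Cons.prems step in auto)
  thus ?case
    by (simp add: algebra_action_mult mult.assoc)
qed

lemma product_functional_alternating:
  assumes m: "\<And>g. m g 0 = 1"
    and "alternating (generated_algebra (generator g)) (generated_algebra (generator (\<not> g))) As"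
    and "\<forall>A\<in>set As. product_functional m (\<lambda>_ _. 0) A = 0"
  shows "product_functional m c (prod_list As) = prod_list (map (product_functional m c) As)"
  using algebra_action_alternating[OF assms, of "\<lambda>v. prod_list (map (case_prod c) v)" 1 c]
  by (simp add: product_functional_def)

lemma c_free_product_functional:
  assumes m: "\<And>g. m g 0 = 1"
  shows "c_free (product_functional m c) (product_functional m (\<lambda>_ _. 0)) (generator True) (generator False)"
  unfolding c_free_iff
proof (intro allI impI)
  fix As
  let ?E = "product_functional m (\<lambda>_ _. 0)"
  assume As: "As \<noteq> [] \<and> (alternating (generated_algebra (generator True)) (generated_algebra (generator False)) As \<or>
      alternating (generated_algebra (generator False)) (generated_algebra (generator True)) As) \<and>
    (\<forall>A\<in>set As. ?E A = 0)"
  \<comment> \<open>The instance \<open>c = 0\<close> gives the claim for \<open>?E\<close>, where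
    the product on the right vanishes.\<close>
  have *: "product_functional m c (prod_list As) = prod_list (map (product_functional m c) As)" for c
    using As product_functional_alternating[of m True As c, OF m]
      product_functional_alternating[of m False As c, OF m] by auto
  have "0 \<in> set (map ?E As)"
    using As by (cases As) auto
  thus "?E (prod_list As) = 0 \<and>
      product_functional m c (prod_list As) = prod_list (map (product_functional m c) As)"
    using prod_list_eq_0 * by metis
qed

text \<open>This gives the definite description in \<open>\<boxtimes>\<^sub>c\<close> something to
  describe.\<close>

lemma c_free_realization_exists:
  assumes ad: "algebraic_distribution \<mu>1" "algebraic_distribution \<nu>1"
    "algebraic_distribution \<mu>2" "algebraic_distribution \<nu>2"
  shows "\<exists>\<theta> E (X :: free_algebra2) Y. c_free_realization \<theta> E X Y (\<mu>1, \<nu>1) (\<mu>2, \<nu>2)"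
proof -
  define m where "m g i = moment_series (if g then \<nu>1 else \<nu>2) $ i" for g i
  \<comment> \<open>The value of a centred power under the first functional is the difference of the
    two moments; adding \<open>m g i\<close> restores the prescribed moment.\<close>
  define c where "c g i = moment_series (if g then \<mu>1 else \<mu>2) $ i - m g i" for g i
  have m0: "m g 0 = 1" and c0: "c g 0 = 0" for g
    using ad by (simp_all add: m_def c_def moment_series_nth_0)
  have \<theta>: "product_functional m c (aeval P (generator g)) = (if g then \<mu>1 else \<mu>2) P" for P g
  proof -
    have "product_functional m c (aeval P (generator g)) =
        (\<Sum>i\<le>degree P. coeff P i * moment_series (if g then \<mu>1 else \<mu>2) $ i)"
      unfolding product_functional_aeval[of m, OF m0]
      by (rule sum.cong) (use c0[of g] in \<open>auto simp: c_def\<close>)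
    thus ?thesis
      using algebraic_distribution_eq_sum[OF ad(1), of P] algebraic_distribution_eq_sum[OF ad(3), of P]
      by simp
  qed
  have E: "product_functional m (\<lambda>_ _. 0) (aeval P (generator g)) = (if g then \<nu>1 else \<nu>2) P" for P g
    using algebraic_distribution_eq_sum[OF ad(2), of P] algebraic_distribution_eq_sum[OF ad(4), of P]
    by (simp add: product_functional_aeval[of m, OF m0] m_def)
  have "c_free_realization (product_functional m c) (product_functional m (\<lambda>_ _. 0))
      (generator True) (generator False) (\<mu>1, \<nu>1) (\<mu>2, \<nu>2)"
    by (simp add: c_free_realization_def unital_functional_product c_free_product_functional m0
        pair_distr_def \<theta> E)
  thus ?thesis by blast
qed


section \<open>Multiplicativity of the bijection\<close>

text \<open>Every realization has the two product series as boolean series, and these determine the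
  pair; so the value is unique, and some realization attains it.\<close>

lemma mult_c_free_conv_eq:
  assumes ad: "algebraic_distribution \<mu>1" "algebraic_distribution \<nu>1"
    "algebraic_distribution \<mu>2" "algebraic_distribution \<nu>2"
    and w: "w1 = fps_X * (boolean_series \<nu>2 oo w2)" "w2 = fps_X * (boolean_series \<nu>1 oo w1)"
  obtains \<mu> \<nu> where "(\<mu>1, \<nu>1) \<boxtimes>\<^sub>c (\<mu>2, \<nu>2) = (\<mu>, \<nu>)"
    "algebraic_distribution \<mu>" "algebraic_distribution \<nu>"
    "boolean_series \<mu> = (boolean_series \<mu>1 oo w1) * (boolean_series \<mu>2 oo w2)"
    "boolean_series \<nu> = (boolean_series \<nu>1 oo w1) * (boolean_series \<nu>2 oo w2)"
proof -
  let ?P = "\<lambda>\<mu> \<nu>. algebraic_distribution \<mu> \<and> algebraic_distribution \<nu> \<and>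
    boolean_series \<mu> = (boolean_series \<mu>1 oo w1) * (boolean_series \<mu>2 oo w2) \<and>
    boolean_series \<nu> = (boolean_series \<nu>1 oo w1) * (boolean_series \<nu>2 oo w2)"
  have real: "?P (fst p) (snd p)"
    if r: "c_free_realization \<theta> E X Y (\<mu>1, \<nu>1) (\<mu>2, \<nu>2)" and p: "p = pair_distr \<theta> E (X * Y)"
    for \<theta> E and X Y :: free_algebra2 and p
  proof -
    have \<theta>: "unital_functional \<theta>" and E: "unital_functional E" and cf: "c_free \<theta> E X Y"
      and d: "\<mu>1 = (\<lambda>P. \<theta> (aeval P X))" "\<nu>1 = (\<lambda>P. E (aeval P X))"
        "\<mu>2 = (\<lambda>P. \<theta> (aeval P Y))" "\<nu>2 = (\<lambda>P. E (aeval P Y))"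
      using r by (auto simp: c_free_realization_def pair_distr_def)
    show ?thesis
      using boolean_series_mult_c_free[OF \<theta> E cf w[unfolded d]]
        boolean_series_mult_c_free[OF E E c_free_diagonal[OF cf] w[unfolded d]]
        algebraic_distribution_aeval[OF \<theta>] algebraic_distribution_aeval[OF E]
      by (simp add: p pair_distr_def d)
  qed
  obtain \<theta> E and X Y :: free_algebra2 where r: "c_free_realization \<theta> E X Y (\<mu>1, \<nu>1) (\<mu>2, \<nu>2)"
    using c_free_realization_exists[OF ad] by blast
  define p where "p = pair_distr \<theta> E (X * Y)"
  have P: "?P (fst p) (snd p)"
    by (rule real[OF r p_def])
  have "(\<mu>1, \<nu>1) \<boxtimes>\<^sub>c (\<mu>2, \<nu>2) = p"
    unfolding mult_c_free_conv_def
  proof (rule the_equality)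
    show "\<exists>\<theta> E (X :: free_algebra2) Y. c_free_realization \<theta> E X Y (\<mu>1, \<nu>1) (\<mu>2, \<nu>2) \<and>
        p = pair_distr \<theta> E (X * Y)"
      using r p_def by blast
  next
    fix p' assume "\<exists>\<theta> E (X :: free_algebra2) Y. c_free_realization \<theta> E X Y (\<mu>1, \<nu>1) (\<mu>2, \<nu>2) \<and>
        p' = pair_distr \<theta> E (X * Y)"
    hence "?P (fst p') (snd p')"
      using real by blast
    thus "p' = p"
      using P boolean_series_inject by (metis prod_eqI)
  qed
  with P show ?thesis
    by (intro that[of "fst p" "snd p"]) auto
qed

text \<open>Polynomials are almost everywhere bounded on the compact support, hence integrable, so
  the integral is additive on them.\<close>

lemma algebraic_distribution_distr_of:
  assumes "compactly_supported_distribution m"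
  shows "algebraic_distribution (distr_of m)"
proof -
  interpret prob_space m
    using assms by (simp add: compactly_supported_distribution_def)
  obtain K where K: "compact K" "AE x in m. x \<in> K" and sets: "sets m = sets borel"
    using assms by (auto simp: compactly_supported_distribution_def)
  have int: "integrable m (\<lambda>x. poly P (complex_of_real x))" for P
  proof -
    have cont: "continuous_on A (\<lambda>x. poly P (complex_of_real x))" for A
      by (intro continuous_intros)
    hence "bounded ((\<lambda>x. poly P (complex_of_real x)) ` K)"
      using K(1) by (intro compact_imp_bounded compact_continuous_image)
    then obtain B where B: "\<And>x. x \<in> K \<Longrightarrow> norm (poly P (complex_of_real x)) \<le> B"
      by (auto simp: bounded_iff)
    have "(\<lambda>x. poly P (complex_of_real x)) \<in> borel_measurable m"
      unfolding measurable_cong_sets[OF sets refl]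
      by (rule borel_measurable_continuous_onI[OF cont])
    moreover have "AE x in m. norm (poly P (complex_of_real x)) \<le> B"
      using K(2) by eventually_elim (rule B)
    ultimately show ?thesis
      by (rule integrable_const_bound[rotated])
  qed
  show ?thesis
    by (simp add: algebraic_distribution_iff distr_of_def int prob_space)
qed

text \<open>
  If \<open>u\<^sub>i = w\<^sub>i \<circ> g\<close> for subordination series \<open>w\<^sub>i\<close>, then \<open>z (k\<^sub>2 \<circ> u\<^sub>2)\<close> and
  \<open>z (k\<^sub>1 \<circ> u\<^sub>1)\<close> are subordination series for the images under \<open>BP\<close>.
\<close>

lemma BP_mult_c_free_conv:
  assumes ad: "algebraic_distribution \<mu>1" "algebraic_distribution \<nu>1"
    "algebraic_distribution \<mu>2" "algebraic_distribution \<nu>2"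
  shows "BP ((\<mu>1, \<nu>1) \<boxtimes>\<^sub>c (\<mu>2, \<nu>2)) = BP (\<mu>1, \<nu>1) \<boxtimes>\<^sub>c BP (\<mu>2, \<nu>2)"
proof -
  let ?k1 = "boolean_series \<nu>1" and ?k2 = "boolean_series \<nu>2"
  obtain w1 w2 where w: "w1 = fps_X * (?k2 oo w2)" "w2 = fps_X * (?k1 oo w1)"
    by (rule subordination_exists)
  have w0: "w1 $ 0 = 0" "w2 $ 0 = 0"
    using arg_cong[OF w(1), of "\<lambda>f. f $ 0"] arg_cong[OF w(2), of "\<lambda>f. f $ 0"] by simp_all
  obtain \<mu> \<nu> where conv: "(\<mu>1, \<nu>1) \<boxtimes>\<^sub>c (\<mu>2, \<nu>2) = (\<mu>, \<nu>)"
    and ad': "algebraic_distribution \<mu>" "algebraic_distribution \<nu>"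
    and bs: "boolean_series \<mu> = (boolean_series \<mu>1 oo w1) * (boolean_series \<mu>2 oo w2)"
      "boolean_series \<nu> = (?k1 oo w1) * (?k2 oo w2)"
    using mult_c_free_conv_eq[OF ad w] by blast
  obtain \<mu>' \<nu>' g where BP: "BP (\<mu>, \<nu>) = (\<mu>', \<nu>')"
    and adBP: "algebraic_distribution \<mu>'" "algebraic_distribution \<nu>'"
    and g: "g = fps_X * (1 + (B_transform \<nu> oo g))"
    and bsBP: "boolean_series \<mu>' = boolean_series \<mu> oo g" "boolean_series \<nu>' = boolean_series \<nu> oo g"
    using BP_eq[OF ad'] by blast
  obtain \<mu>1' \<nu>1' g1 where BP1: "BP (\<mu>1, \<nu>1) = (\<mu>1', \<nu>1')"
    and ad1: "algebraic_distribution \<mu>1'" "algebraic_distribution \<nu>1'"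
    and g1: "g1 = fps_X * (1 + (B_transform \<nu>1 oo g1))"
    and bs1: "boolean_series \<mu>1' = boolean_series \<mu>1 oo g1" "boolean_series \<nu>1' = ?k1 oo g1"
    using BP_eq[OF ad(1,2)] by blast
  obtain \<mu>2' \<nu>2' g2 where BP2: "BP (\<mu>2, \<nu>2) = (\<mu>2', \<nu>2')"
    and ad2: "algebraic_distribution \<mu>2'" "algebraic_distribution \<nu>2'"
    and g2: "g2 = fps_X * (1 + (B_transform \<nu>2 oo g2))"
    and bs2: "boolean_series \<mu>2' = boolean_series \<mu>2 oo g2" "boolean_series \<nu>2' = ?k2 oo g2"
    using BP_eq[OF ad(3,4)] by blast
  have start: "h $ 0 = 0" if "h = fps_X * (1 + (b oo h))" for h b :: "complex fps"
    using arg_cong[OF that, of "\<lambda>f. f $ 0"] by simp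
  have g0: "g $ 0 = 0" "g1 $ 0 = 0" "g2 $ 0 = 0"
    by (rule start[OF g] start[OF g1] start[OF g2])+
  define u1 u2 where "u1 = w1 oo g" and "u2 = w2 oo g"
  \<comment> \<open>These are the candidates for the new subordination series; the goal is that
    \<open>g1 oo v1\<close> is \<open>u1\<close> and \<open>g2 oo v2\<close> is
    \<open>u2\<close>.\<close>
  define v1 v2 where "v1 = fps_X * (?k2 oo u2)" and "v2 = fps_X * (?k1 oo u1)"
  have u0: "u1 $ 0 = 0" "u2 $ 0 = 0" and v0: "v1 $ 0 = 0" "v2 $ 0 = 0"
    by (simp_all add: u1_def u2_def v1_def v2_def w0)
  have u: "u1 = g * (?k2 oo u2)" "u2 = g * (?k1 oo u1)"
  proof -
    have "w1 oo g = g * (?k2 oo u2)" "w2 oo g = g * (?k1 oo u1)"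
      by (subst w, simp add: u1_def u2_def fps_compose_mult_distrib fps_compose_assoc g0 w0)+
    thus "u1 = g * (?k2 oo u2)" "u2 = g * (?k1 oo u1)"
      by (simp_all only: u1_def u2_def)
  qed
  have "boolean_series \<nu> oo g = (?k1 oo u1) * (?k2 oo u2)"
    by (simp add: bs u1_def u2_def fps_compose_mult_distrib fps_compose_assoc g0 w0)
  hence g': "g = fps_X * (1 + g * ((?k1 oo u1) * (?k2 oo u2)))"
    using g by (simp add: B_transform_eq[OF ad'(2)] fps_compose_mult_distrib g0)
  \<comment> \<open>Both \<open>h oo v\<close> and \<open>u\<close> are fixed points of the
    contraction with factor \<open>v\<close>: the first by substituting \<open>v\<close> into the
    equation of \<open>h\<close>, the second by \<open>eq\<close>.\<close>
  have fixed: "h oo v = u"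
    if h: "h = fps_X * (1 + (B_transform \<sigma> oo h))" and v: "v $ 0 = 0" and u: "u $ 0 = 0"
      and eq: "u = v * (1 + u * (boolean_series \<sigma> oo u))" and \<sigma>: "algebraic_distribution \<sigma>"
    for h u v and \<sigma>
  proof (rule fps_contraction_unique[OF fps_contraction_tree[OF v]])
    show "v * (1 + (B_transform \<sigma> oo u)) = u"
      using eq by (simp add: B_transform_eq[OF \<sigma>] fps_compose_mult_distrib u)
    have "h oo v = v * (1 + (B_transform \<sigma> oo h oo v))"
      by (subst h) (simp add: fps_compose_mult_distrib fps_compose_add_distrib v)
    thus "v * (1 + (B_transform \<sigma> oo (h oo v))) = h oo v"
      unfolding fps_compose_assoc[OF v start[OF h]] by (rule sym)
  qed
  \<comment> \<open>The brackets in the equations for \<open>u1\<close> and \<open>u2\<close> thus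
    agree with the one in \<open>g'\<close>; z times it is \<open>g\<close>, and \<open>u\<close>
    then turns \<open>g * (?k2 oo u2)\<close> into \<open>u1\<close>, and symmetrically for
    \<open>u2\<close>.\<close>
  have t: "u1 * (?k1 oo u1) = g * ((?k1 oo u1) * (?k2 oo u2))"
    "u2 * (?k2 oo u2) = g * ((?k1 oo u1) * (?k2 oo u2))"
    by (subst u(1), simp only: mult_ac, subst u(2), simp only: mult_ac)
  have "v1 * (1 + u1 * (?k1 oo u1)) = fps_X * (1 + g * ((?k1 oo u1) * (?k2 oo u2))) * (?k2 oo u2)"
    unfolding t by (simp only: v1_def mult_ac)
  hence "u1 = v1 * (1 + u1 * (?k1 oo u1))"
    by (simp only: g'[symmetric] u(1)[symmetric])
  hence u1: "g1 oo v1 = u1"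
    by (rule fixed[OF g1 v0(1) u0(1) _ ad(2)])
  have "v2 * (1 + u2 * (?k2 oo u2)) = fps_X * (1 + g * ((?k1 oo u1) * (?k2 oo u2))) * (?k1 oo u1)"
    unfolding t by (simp only: v2_def mult_ac)
  hence "u2 = v2 * (1 + u2 * (?k2 oo u2))"
    by (simp only: g'[symmetric] u(2)[symmetric])
  hence u2: "g2 oo v2 = u2"
    by (rule fixed[OF g2 v0(2) u0(2) _ ad(4)])
  have v: "v1 = fps_X * (boolean_series \<nu>2' oo v2)" "v2 = fps_X * (boolean_series \<nu>1' oo v1)"
    by (simp_all add: bs1 bs2 v1_def[symmetric] v2_def[symmetric] u1 u2 fps_compose_assoc[symmetric] v0 g0)
  obtain \<mu>'' \<nu>'' where conv': "(\<mu>1', \<nu>1') \<boxtimes>\<^sub>c (\<mu>2', \<nu>2') = (\<mu>'', \<nu>'')"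
    and ad'': "algebraic_distribution \<mu>''" "algebraic_distribution \<nu>''"
    and bs'': "boolean_series \<mu>'' = (boolean_series \<mu>1' oo v1) * (boolean_series \<mu>2' oo v2)"
      "boolean_series \<nu>'' = (boolean_series \<nu>1' oo v1) * (boolean_series \<nu>2' oo v2)"
    using mult_c_free_conv_eq[OF ad1 ad2 v] by blast
  \<comment> \<open>Both sides are \<open>f oo u1\<close>, respectively \<open>f oo u2\<close>:
    applying \<open>BP\<close> before or after the convolution gives the same substitution.\<close>
  have sub: "f oo g1 oo v1 = f oo w1 oo g" "f oo g2 oo v2 = f oo w2 oo g" for f
    by (simp_all add: fps_compose_assoc[symmetric] v0 g0 w0 u1 u2 u1_def u2_def)
  have "boolean_series \<mu>'' = boolean_series \<mu>'" "boolean_series \<nu>'' = boolean_series \<nu>'"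
    by (simp_all add: bs'' bs1 bs2 bsBP bs sub fps_compose_mult_distrib g0)
  hence "\<mu>'' = \<mu>'" "\<nu>'' = \<nu>'"
    using boolean_series_inject ad'' adBP by blast+
  thus ?thesis
    by (simp add: conv BP BP1 BP2 conv')
qed

theorem proposition5p2:
  fixes m1 n1 m2 n2 :: "real measure"
  assumes "compactly_supported_distribution m1" and "compactly_supported_distribution n1"
    and "compactly_supported_distribution m2" and "compactly_supported_distribution n2"
  shows "BP ((distr_of m1, distr_of n1) \<boxtimes>\<^sub>c (distr_of m2, distr_of n2)) =
    BP (distr_of m1, distr_of n1) \<boxtimes>\<^sub>c BP (distr_of m2, distr_of n2)"
  by (intro BP_mult_c_free_conv algebraic_distribution_distr_of assms)

end
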